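(* Let $G_1$ and $G_2$ be torsion-free nilpotent groups, and for $i=1,2$ let $S_i$ be a finite symmetric generating set of $G_i$. Then every graph isomorphism from $\mathrm{Cay}(G_1;S_1)$ to $\mathrm{Cay}(G_2;S_2)$ is an affine bijection.
   Context: For a group $G$ and a symmetric subset $S$ ($S=S^{-1}$), $\mathrm{Cay}(G;S)$ is the graph with vertex set $G$ in which $g$ is adjacent to $gs$ for all $g\in G$, $s\in S$. A map $\varphi\colon G_1\to G_2$ between groups is an affine bijection if there exist a group isomorphism $\alpha\colon G_1\to G_2$ and $h\in G_2$ such that $\varphi(x)=h\,\alpha(x)$ for all $x\in G_1$. *)

theory Defs
  imports
    "HOL-Algebra.Generated_Groups"
    "Graph_Theory.Pair_Digraph"
    "Graph_Theory.Digraph_Isomorphism"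
begin

definition torsion_free :: "('a, 'm) monoid_scheme \<Rightarrow> bool" where
  "torsion_free G \<longleftrightarrow>
     (\<forall>x \<in> carrier G. \<forall>n::nat. 0 < n \<and> x [^]\<^bsub>G\<^esub> n = \<one>\<^bsub>G\<^esub> \<longrightarrow> x = \<one>\<^bsub>G\<^esub>)"

definition commutator :: "('a, 'm) monoid_scheme \<Rightarrow> 'a \<Rightarrow> 'a \<Rightarrow> 'a" where
  "commutator G x y = x \<otimes>\<^bsub>G\<^esub> y \<otimes>\<^bsub>G\<^esub> inv\<^bsub>G\<^esub> x \<otimes>\<^bsub>G\<^esub> inv\<^bsub>G\<^esub> y"

primrec lower_central_series :: "('a, 'm) monoid_scheme \<Rightarrow> nat \<Rightarrow> 'a set" where
  "lower_central_series G 0 = carrier G"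
| "lower_central_series G (Suc n) =
     generate G {commutator G x y | x y. x \<in> lower_central_series G n \<and> y \<in> carrier G}"

definition nilpotent :: "('a, 'm) monoid_scheme \<Rightarrow> bool" where
  "nilpotent G \<longleftrightarrow> (\<exists>n. lower_central_series G n = {\<one>\<^bsub>G\<^esub>})"

definition symmetric_subset :: "('a, 'm) monoid_scheme \<Rightarrow> 'a set \<Rightarrow> bool" where
  "symmetric_subset G S \<longleftrightarrow> S \<subseteq> carrier G \<and> set_inv\<^bsub>G\<^esub> S = S"

definition generating_set :: "('a, 'm) monoid_scheme \<Rightarrow> 'a set \<Rightarrow> bool" where
  "generating_set G S \<longleftrightarrow> S \<subseteq> carrier G \<and> generate G S = carrier G"

text \<open>An undirected graph without multiple edges is a symmetric arc relation on its vertex set.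
  If \<open>\<one> \<in> S\<close> then every vertex of the Cayley graph carries a loop.\<close>

definition cayley_graph :: "('a, 'm) monoid_scheme \<Rightarrow> 'a set \<Rightarrow> 'a pair_pre_digraph" where
  "cayley_graph G S =
     \<lparr>pverts = carrier G, parcs = {(g, g \<otimes>\<^bsub>G\<^esub> s) | g s. g \<in> carrier G \<and> s \<in> S}\<rparr>"

lemma (in group) cayley_graph_sym:
  assumes "symmetric_subset G S"
  shows "pair_sym_digraph (cayley_graph G S)"
proof -
  have S: "S \<subseteq> carrier G" and inv_S: "\<And>s. s \<in> S \<Longrightarrow> inv s \<in> S"
    using assms by (auto simp: symmetric_subset_def SET_INV_def)
  have "(g \<otimes> s, g) \<in> parcs (cayley_graph G S)" if "g \<in> carrier G" "s \<in> S" for g s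
  proof -
    have "g = (g \<otimes> s) \<otimes> inv s"
      using that S by (auto simp: m_assoc)
    then show ?thesis
      using that S inv_S by (auto simp: cayley_graph_def)
  qed
  then have "sym (parcs (cayley_graph G S))"
    by (auto simp: sym_def cayley_graph_def)
  then show ?thesis
    using S by unfold_locales (auto simp: cayley_graph_def symmetric_def)
qed

definition graph_isomorphism ::
    "'a pair_pre_digraph \<Rightarrow> 'b pair_pre_digraph \<Rightarrow> ('a \<Rightarrow> 'b) \<Rightarrow> bool" where
  "graph_isomorphism \<Gamma> \<Delta> \<phi> \<longleftrightarrow>
     bij_betw \<phi> (pverts \<Gamma>) (pverts \<Delta>) \<and>
     (\<forall>u \<in> pverts \<Gamma>. \<forall>v \<in> pverts \<Gamma>. (u, v) \<in> parcs \<Gamma> \<longleftrightarrow> (\<phi> u, \<phi> v) \<in> parcs \<Delta>)"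

lemma graph_isomorphism_iff_digraph_isomorphism:
  assumes "pair_wf_digraph \<Gamma>" and "pair_wf_digraph \<Delta>"
  shows "graph_isomorphism \<Gamma> \<Delta> \<phi> \<longleftrightarrow>
    (\<exists>f. pre_digraph.digraph_isomorphism (with_proj \<Gamma>) f \<and>
         with_proj \<Delta> = app_iso f (with_proj \<Gamma>) \<and> iso_verts f = \<phi>)"
    (is "?L \<longleftrightarrow> ?R")
proof
  interpret A: pair_wf_digraph \<Gamma> by fact
  interpret B: pair_wf_digraph \<Delta> by fact
  have wf: "wf_digraph (with_proj \<Gamma>)"
    by unfold_locales auto
  {
    assume L: ?L
    let ?f = "\<lparr>iso_verts = \<phi>, iso_arcs = map_prod \<phi> \<phi>, iso_head = snd, iso_tail = fst\<rparr>"
    have inj: "inj_on \<phi> (pverts \<Gamma>)" and im: "\<phi> ` pverts \<Gamma> = pverts \<Delta>"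
      using L by (auto simp: graph_isomorphism_def bij_betw_def)
    have "inj_on (map_prod \<phi> \<phi>) (parcs \<Gamma>)"
      by (rule inj_on_subset[OF map_prod_inj_on[OF inj inj]]) (auto dest: A.wellformed')
    moreover have "parcs \<Delta> = map_prod \<phi> \<phi> ` parcs \<Gamma>"
    proof (intro subset_antisym subsetI)
      fix e assume e: "e \<in> parcs \<Delta>"
      then obtain u v where "u \<in> pverts \<Gamma>" "v \<in> pverts \<Gamma>" "e = (\<phi> u, \<phi> v)"
        using im B.wellformed' by (metis imageE surj_pair)
      then show "e \<in> map_prod \<phi> \<phi> ` parcs \<Gamma>"
        using L e by (force simp: graph_isomorphism_def)
    next
      fix e assume "e \<in> map_prod \<phi> \<phi> ` parcs \<Gamma>"
      then show "e \<in> parcs \<Delta>"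
        using L by (auto simp: graph_isomorphism_def dest: A.wellformed')
    qed
    ultimately have "pre_digraph.digraph_isomorphism (with_proj \<Gamma>) ?f \<and>
         with_proj \<Delta> = app_iso ?f (with_proj \<Gamma>) \<and> iso_verts ?f = \<phi>"
      using inj im wf
      by (auto simp: pre_digraph.digraph_isomorphism_def app_iso_def with_proj_def)
    then show ?R by blast
  next
    assume ?R
    then obtain f where f: "pre_digraph.digraph_isomorphism (with_proj \<Gamma>) f"
      "with_proj \<Delta> = app_iso f (with_proj \<Gamma>)" and \<phi>: "iso_verts f = \<phi>" by blast
    have inj: "inj_on \<phi> (pverts \<Gamma>)" and im: "\<phi> ` pverts \<Gamma> = pverts \<Delta>"
      and arcs: "parcs \<Delta> = iso_arcs f ` parcs \<Gamma>" and tl: "iso_tail f = fst" "iso_head f = snd"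
      using f \<phi> by (auto simp: pre_digraph.digraph_isomorphism_def app_iso_def with_proj_def)
    have "iso_arcs f e = map_prod \<phi> \<phi> e" if "e \<in> parcs \<Gamma>" for e
      using f(1) \<phi> tl that
      by (auto simp: pre_digraph.digraph_isomorphism_def prod_eq_iff)
    then have arcs': "parcs \<Delta> = map_prod \<phi> \<phi> ` parcs \<Gamma>"
      using arcs by auto
    have "(u, v) \<in> parcs \<Gamma>"
      if uv: "u \<in> pverts \<Gamma>" "v \<in> pverts \<Gamma>" "(\<phi> u, \<phi> v) \<in> parcs \<Delta>" for u v
    proof -
      obtain u' v' where "(u', v') \<in> parcs \<Gamma>" "\<phi> u = \<phi> u'" "\<phi> v = \<phi> v'"
        using uv(3) arcs' by auto
      then show ?thesis
        using inj uv A.wellformed' by (metis inj_onD)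
    qed
    then show ?L
      using inj im arcs' by (force simp: graph_isomorphism_def bij_betw_def)
  }
qed

definition affine_bijection ::
    "('a, 'm) monoid_scheme \<Rightarrow> ('b, 'n) monoid_scheme \<Rightarrow> ('a \<Rightarrow> 'b) \<Rightarrow> bool" where
  "affine_bijection G H \<phi> \<longleftrightarrow>
     (\<exists>\<alpha> \<in> iso G H. \<exists>h \<in> carrier H. \<forall>x \<in> carrier G. \<phi> x = h \<otimes>\<^bsub>H\<^esub> \<alpha> x)"

end

theory Submission
  imports Defs Complex_Main
begin

text \<open>
  Normalise \<open>\<phi> \<one> = \<one>\<close>; the claim is that \<open>\<phi>\<close> is a homomorphism, by induction on the nilpotency class.

  On a nilpotent group, bounded harmonic functions are constant and Lipschitz harmonic functions are
  homomorphisms to the reals up to a constant. Since \<open>\<phi>\<close> preserves harmonicity, \<open>\<chi> \<circ> \<phi>\<close> is a homomorphism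
  for every homomorphism \<open>\<chi>\<close> from \<open>G\<^sub>2\<close> to the reals. Hence, if \<open>N\<^sub>i\<close> denotes the common kernel of all
  homomorphisms from \<open>G\<^sub>i\<close> to the reals, \<open>\<phi>\<close> is a homomorphism modulo \<open>N\<^sub>2\<close> and maps cosets of \<open>N\<^sub>1\<close> to
  cosets of \<open>N\<^sub>2\<close>. As \<open>[\<zeta>\<^bsub>j+2\<^esub>, N] \<subseteq> \<zeta>\<^sub>j\<close> for the upper central series \<open>\<zeta>\<close>, the class of \<open>N\<^sub>i\<close> is smaller, and
  by induction \<open>\<phi>\<close> and all its translates \<open>x \<mapsto> \<phi>(g)\<^sup>-\<^sup>1 \<phi>(g x)\<close> are homomorphisms on \<open>N\<^sub>1\<close>. Homomorphisms into a
  torsion-free nilpotent group that stay at bounded distance coincide, which yields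
  \<open>\<phi>(m g) = \<phi>(m) \<phi>(g)\<close> for \<open>m \<in> N\<^sub>1\<close>.

  Finally one shows \<open>t = \<phi>(h)\<^sup>-\<^sup>1 \<phi>(g)\<^sup>-\<^sup>1 \<phi>(g h) \<in> \<zeta>\<^sub>j\<close> by downward induction on \<open>j\<close>. The permutation
  \<open>\<psi>(y) = \<phi>(g)\<^sup>-\<^sup>1 \<phi>(g \<phi>\<^sup>-\<^sup>1(y))\<close> has finite orbits because it preserves balls around \<open>\<one>\<close>, while
  \<open>\<psi>\<^sup>i(y) \<equiv> y t\<^sup>i\<close> modulo \<open>\<zeta>\<^sub>j\<close> for \<open>y = \<phi>(h)\<close>; so a power of \<open>t\<close> lies in \<open>\<zeta>\<^sub>j\<close>, and therefore so does \<open>t\<close>.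

  Connectedness of the graphs is not inherited by the subgroups \<open>N\<^sub>i\<close>. The induction therefore replaces
  generating sets by families of finite symmetric sets \<open>R n\<close> that cover the group.
\<close>

section \<open>Upper central series\<close>

text \<open>Term \<open>n + 1\<close> is the preimage of the centre of the quotient by term
  \<open>n\<close>. The formulation with commutators keeps all terms inside
  \<open>G\<close>.\<close>

primrec upper_central_series :: "('a, 'm) monoid_scheme \<Rightarrow> nat \<Rightarrow> 'a set" where
  "upper_central_series G 0 = {\<one>\<^bsub>G\<^esub>}"
| "upper_central_series G (Suc n) =
     {x \<in> carrier G. \<forall>g \<in> carrier G. commutator G x g \<in> upper_central_series G n}"

lemma pigeonhole_sequence:
  fixes h :: "nat \<Rightarrow> 'a"
  assumes "finite F" "\<And>n. h n \<in> F"
  obtains i j where "i < j" "h i = h j"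
proof -
  have "finite (range h)"
    using assms by (meson finite_subset image_subsetI)
  then have "\<not> inj h"
    using finite_imageD infinite_UNIV_nat by blast
  then obtain i j where "i \<noteq> j" "h i = h j"
    by (auto simp: inj_def)
  then show ?thesis
    using that by (metis linorder_neqE_nat)
qed

context group
begin

lemma inv_cancel_left [simp]:
  "x \<in> carrier G \<Longrightarrow> y \<in> carrier G \<Longrightarrow> inv x \<otimes> (x \<otimes> y) = y"
  "x \<in> carrier G \<Longrightarrow> y \<in> carrier G \<Longrightarrow> x \<otimes> (inv x \<otimes> y) = y"
  by (simp_all flip: m_assoc)

lemma commutator_closed [simp]:
  "x \<in> carrier G \<Longrightarrow> y \<in> carrier G \<Longrightarrow> commutator G x y \<in> carrier G"
  by (simp add: commutator_def)

lemma inv_commutator: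
  "x \<in> carrier G \<Longrightarrow> y \<in> carrier G \<Longrightarrow> inv (commutator G x y) = commutator G y x"
  by (simp add: commutator_def m_assoc inv_mult_group)

lemma commutator_mult: "x \<in> carrier G \<Longrightarrow> y \<in> carrier G \<Longrightarrow> commutator G x y \<otimes> (y \<otimes> x) = x \<otimes> y"
  by (simp add: commutator_def m_assoc)

lemma commutator_eq_one_iff:
  assumes "x \<in> carrier G" "y \<in> carrier G"
  shows "commutator G x y = \<one> \<longleftrightarrow> x \<otimes> y = y \<otimes> x"
proof
  assume "commutator G x y = \<one>"
  then show "x \<otimes> y = y \<otimes> x"
    using commutator_mult[OF assms] assms by simp
next
  assume "x \<otimes> y = y \<otimes> x"
  then show "commutator G x y = \<one>"
    using assms by (simp add: commutator_def m_assoc)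
qed

lemma conj_pow:
  assumes "z \<in> carrier G" "y \<in> carrier G"
  shows "(z \<otimes> y \<otimes> inv z) [^] (k::nat) = z \<otimes> y [^] k \<otimes> inv z"
  using assms by (induction k) (simp_all add: m_assoc)

lemma pow_eq_pow_imp_one:
  assumes "x \<in> carrier G" "i < j" "x [^] (i::nat) = x [^] j"
  shows "x [^] (j - i) = \<one>"
proof -
  have "x [^] i \<otimes> x [^] (j - i) = x [^] j"
    using assms(1,2) by (simp add: nat_pow_mult)
  then have "x [^] i \<otimes> x [^] (j - i) = x [^] i"
    using assms(3) by simp
  then show ?thesis
    using assms by simp
qed

lemma commutator_mult_left:
  assumes "x \<in> carrier G" "y \<in> carrier G" "g \<in> carrier G"
  shows "commutator G (x \<otimes> y) g = x \<otimes> commutator G y g \<otimes> inv x \<otimes> commutator G x g"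
  using assms by (simp add: commutator_def m_assoc inv_mult_group)

lemma commutator_inv_left:
  assumes "x \<in> carrier G" "g \<in> carrier G"
  shows "commutator G (inv x) g = inv x \<otimes> inv (commutator G x g) \<otimes> inv (inv x)"
  using assms by (simp add: commutator_def m_assoc inv_mult_group)

lemma commutator_conj_left:
  assumes "x \<in> carrier G" "g \<in> carrier G" "h \<in> carrier G"
  shows "commutator G (h \<otimes> x \<otimes> inv h) g = h \<otimes> commutator G x (inv h \<otimes> g \<otimes> h) \<otimes> inv h"
  using assms by (simp add: commutator_def m_assoc inv_mult_group)

lemma upper_central_series_normal: "upper_central_series G n \<lhd> G"
proof (induction n)
  case 0
  show ?case
    using one_is_normal by simp
next
  case (Suc n)
  then interpret N: normal "upper_central_series G n" G .
  let ?U = "upper_central_series G (Suc n)"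
  have "subgroup ?U G"
  proof (rule subgroupI)
    show "?U \<subseteq> carrier G" by auto
    have "\<one> \<in> ?U"
      using N.one_closed by (simp add: commutator_def)
    then show "?U \<noteq> {}" by blast
    show "inv a \<in> ?U" if "a \<in> ?U" for a
      using that by (auto simp: commutator_inv_left intro!: N.inv_op_closed2 N.inv_op_closed1)
    show "a \<otimes> b \<in> ?U" if "a \<in> ?U" "b \<in> ?U" for a b
      using that by (auto simp: commutator_mult_left N.inv_op_closed2)
  qed
  moreover have "h \<otimes> x \<otimes> inv h \<in> ?U" if "x \<in> ?U" "h \<in> carrier G" for x h
    using that by (auto simp: commutator_conj_left N.inv_op_closed2)
  ultimately show ?case
    by (auto simp: normal_inv_iff)
qed

lemma upper_central_series_subgroup: "subgroup (upper_central_series G n) G"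
  using upper_central_series_normal normal_imp_subgroup by blast

lemma upper_central_series_subset: "upper_central_series G n \<subseteq> carrier G"
  using upper_central_series_subgroup subgroup.subset by blast

lemma upper_central_series_Suc_mono: "upper_central_series G n \<subseteq> upper_central_series G (Suc n)"
proof (induction n)
  case 0
  show ?case by (auto simp: commutator_def)
next
  case (Suc n)
  then show ?case
    using upper_central_series_subset by auto
qed

lemma upper_central_series_mono: "m \<le> n \<Longrightarrow> upper_central_series G m \<subseteq> upper_central_series G n"
  by (rule lift_Suc_mono_le[of "upper_central_series G"]) (use upper_central_series_Suc_mono in auto)

lemma commutator_in_upper_central_series:
  assumes "x \<in> upper_central_series G (Suc n)" "g \<in> carrier G"
  shows "commutator G x g \<in> upper_central_series G n" "commutator G g x \<in> upper_central_series G n"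
proof -
  show 1: "commutator G x g \<in> upper_central_series G n"
    using assms by simp
  show "commutator G g x \<in> upper_central_series G n"
    using subgroup.m_inv_closed[OF upper_central_series_subgroup 1] assms by (simp add: inv_commutator)
qed

text \<open>Calculations modulo term \<open>n\<close> take place in the group \<open>Q\<close>, of
  which only the homomorphism \<open>p\<close> and its kernel matter later.\<close>

lemma upper_central_series_quotient:
  obtains Q :: "'a set monoid" and p where "group_hom G Q p"
    "\<And>x. x \<in> carrier G \<Longrightarrow> p x = \<one>\<^bsub>Q\<^esub> \<longleftrightarrow> x \<in> upper_central_series G n"
proof -
  interpret N: normal "upper_central_series G n" G
    by (rule upper_central_series_normal)
  let ?p = "\<lambda>x. upper_central_series G n #> x"
  have "group_hom G (G Mod upper_central_series G n) ?p"
    using N.factorgroup_is_group N.r_coset_hom_Mod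
    by (simp add: group_hom_def group_hom_axioms_def)
  moreover have "?p x = \<one>\<^bsub>G Mod upper_central_series G n\<^esub> \<longleftrightarrow> x \<in> upper_central_series G n"
    if "x \<in> carrier G" for x
    using that coset_join1 coset_join2 N.subset N.subgroup_axioms by (metis one_FactGroup)
  ultimately show ?thesis
    using that by blast
qed

end

lemma (in group_hom) hom_commutator:
  "x \<in> carrier G \<Longrightarrow> y \<in> carrier G \<Longrightarrow> h (commutator G x y) = commutator H (h x) (h y)"
  by (simp add: commutator_def)

section \<open>Torsion-freeness modulo the terms of the upper central series\<close>

context group
begin

text \<open>Modulo term \<open>n\<close> the commutator \<open>c\<close> of \<open>z\<close> and
  \<open>y\<close> commutes with \<open>y\<close>, so conjugating \<open>y [^] k\<close> by
  \<open>z\<close> gives \<open>(c \<otimes> y) [^] k = c [^] k \<otimes> y [^] k\<close>.\<close>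

lemma commutator_pow_upper_central_series:
  assumes "z \<in> carrier G" "y \<in> carrier G" and c: "commutator G z y \<in> upper_central_series G (Suc n)"
  shows "commutator G z (y [^] (k::nat)) \<in> upper_central_series G n \<longleftrightarrow>
         commutator G z y [^] k \<in> upper_central_series G n"
proof -
  obtain Q :: "'a set monoid" and p where p: "group_hom G Q p"
    "\<And>x. x \<in> carrier G \<Longrightarrow> p x = \<one>\<^bsub>Q\<^esub> \<longleftrightarrow> x \<in> upper_central_series G n"
    using upper_central_series_quotient by blast
  interpret p: group_hom G Q p by (rule p)
  let ?c = "commutator G z y"
  have "commutator G ?c y \<in> upper_central_series G n"
    using c assms by simp
  then have comm: "p ?c \<otimes>\<^bsub>Q\<^esub> p y = p y \<otimes>\<^bsub>Q\<^esub> p ?c"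
    using p(2)[of "commutator G ?c y"] assms
    by (simp add: p.hom_commutator p.H.commutator_eq_one_iff)
  have "p (z \<otimes> y [^] k \<otimes> inv z) = (p (z \<otimes> y \<otimes> inv z)) [^]\<^bsub>Q\<^esub> k"
    using assms by (simp add: p.hom_nat_pow flip: conj_pow)
  also have "z \<otimes> y \<otimes> inv z = ?c \<otimes> y"
    using assms by (simp add: commutator_def m_assoc)
  also have "p (?c \<otimes> y) [^]\<^bsub>Q\<^esub> k = p ?c [^]\<^bsub>Q\<^esub> k \<otimes>\<^bsub>Q\<^esub> p y [^]\<^bsub>Q\<^esub> k"
    using assms(1,2) p.H.pow_mult_distrib[OF comm] by simp
  finally have "p (z \<otimes> y [^] k \<otimes> inv z) \<otimes>\<^bsub>Q\<^esub> inv\<^bsub>Q\<^esub> p (y [^] k) = p (?c [^] k)"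
    using assms by (simp add: p.hom_nat_pow p.H.m_assoc)
  then have "p (commutator G z (y [^] k)) = p (?c [^] k)"
    using assms by (simp add: commutator_def)
  then show ?thesis
    using p(2) assms by (metis commutator_closed nat_pow_closed)
qed

text \<open>Each factor of the series inherits torsion-freeness from the one below: for
  \<open>x\<close> in term \<open>n + 2\<close> with \<open>x [^] k\<close> in term
  \<open>n + 1\<close>, the \<open>k\<close>-th power of every commutator of \<open>g\<close> with
  \<open>x\<close> lies in term \<open>n\<close>, hence so does the commutator by induction.\<close>

lemma upper_central_series_step_isolated:
  assumes "torsion_free G" "0 < k"
  shows "x \<in> upper_central_series G (Suc n) \<Longrightarrow> x [^] (k::nat) \<in> upper_central_series G n \<Longrightarrow>
    x \<in> upper_central_series G n"
proof (induction n arbitrary: x)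
  case 0
  then show ?case
    using assms by (auto simp: torsion_free_def)
next
  case (Suc n)
  have x: "x \<in> carrier G"
    using Suc.prems by simp
  have "commutator G x g \<in> upper_central_series G n" if g: "g \<in> carrier G" for g
  proof -
    have "commutator G g x \<in> upper_central_series G (Suc n)"
      using Suc.prems(1) g commutator_in_upper_central_series by blast
    moreover have "commutator G g (x [^] k) \<in> upper_central_series G n"
      using Suc.prems(2) g commutator_in_upper_central_series by blast
    ultimately have "commutator G g x \<in> upper_central_series G n"
      using Suc.IH commutator_pow_upper_central_series[OF g x] by blast
    then show ?thesis
      using inv_commutator[OF g x] subgroup.m_inv_closed[OF upper_central_series_subgroup] by metis
  qed
  then show ?case
    using x by simp
qed

text \<open>Descent from term \<open>n + d\<close> to term \<open>n\<close>, one torsion-free factor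
  at a time; it can start because term \<open>c\<close> is the whole group.\<close>

lemma upper_central_series_isolated:
  assumes "torsion_free G" "upper_central_series G c = carrier G"
    and "x \<in> carrier G" "0 < k" "x [^] (k::nat) \<in> upper_central_series G n"
  shows "x \<in> upper_central_series G n"
proof -
  have "x \<in> upper_central_series G (n + d) \<Longrightarrow> x \<in> upper_central_series G n" for d
  proof (induction d)
    case (Suc d)
    have "x [^] k \<in> upper_central_series G (n + d)"
      using assms(5) upper_central_series_mono[of n "n + d"] by (simp add: subset_iff)
    with Suc show ?case
      by (metis add_Suc_right upper_central_series_step_isolated[OF assms(1,4)])
  qed simp
  moreover have "x \<in> upper_central_series G (n + c)"
    using assms(2,3) upper_central_series_mono[of c "n + c"] by (simp add: subset_iff)
  ultimately show ?thesis .
qed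

text \<open>The same descent for a commutator: at each level its \<open>k\<close>-th power agrees
  with the commutator with \<open>y [^] k\<close> up to the next lower term.\<close>

lemma commutator_pow_isolated:
  assumes "torsion_free G" "upper_central_series G c = carrier G"
    and "z \<in> carrier G" "y \<in> carrier G" "0 < k"
    and "commutator G z (y [^] (k::nat)) \<in> upper_central_series G n"
  shows "commutator G z y \<in> upper_central_series G n"
proof -
  have "commutator G z y \<in> upper_central_series G (n + d) \<Longrightarrow>
      commutator G z y \<in> upper_central_series G n" for d
  proof (induction d)
    case (Suc d)
    have "commutator G z (y [^] k) \<in> upper_central_series G (n + d)"
      using assms(6) upper_central_series_mono[of n "n + d"] by (simp add: subset_iff)
    then have "commutator G z y [^] k \<in> upper_central_series G (n + d)"
      using Suc.prems by (metis add_Suc_right commutator_pow_upper_central_series[OF assms(3,4)])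
    then show ?case
      using Suc.IH upper_central_series_isolated[OF assms(1,2) commutator_closed[OF assms(3,4)] assms(5)]
      by blast
  qed simp
  moreover have "commutator G z y \<in> upper_central_series G (n + c)"
    using assms(2-4) upper_central_series_mono[of c "n + c"] by (simp add: subset_iff)
  ultimately show ?thesis .
qed

text \<open>Two of the conjugates agree modulo term \<open>n\<close>, so a positive power of
  \<open>y\<close> commutes with \<open>a\<close> there, and \<open>y\<close> itself does by
  isolation. The factor \<open>l\<close> disappears in the quotient; it is allowed because one
  application knows the conjugates only up to term \<open>n\<close>.\<close>

lemma commutator_mem_if_finite_conjugates:
  assumes "torsion_free G" "upper_central_series G c = carrier G"
    and "a \<in> carrier G" "y \<in> carrier G" "finite F"
    and F: "\<And>k::nat. \<exists>l \<in> upper_central_series G n. inv (y [^] k) \<otimes> (l \<otimes> a) \<otimes> y [^] k \<in> F"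
  shows "commutator G a y \<in> upper_central_series G n"
proof -
  obtain Q :: "'a set monoid" and p where p: "group_hom G Q p"
    "\<And>x. x \<in> carrier G \<Longrightarrow> p x = \<one>\<^bsub>Q\<^esub> \<longleftrightarrow> x \<in> upper_central_series G n"
    using upper_central_series_quotient by blast
  interpret p: group_hom G Q p by (rule p)
  have "p (inv (y [^] k) \<otimes> a \<otimes> y [^] k) \<in> p ` F" for k :: nat
  proof -
    obtain l where l: "l \<in> upper_central_series G n" "inv (y [^] k) \<otimes> (l \<otimes> a) \<otimes> y [^] k \<in> F"
      using F by blast
    then have "l \<in> carrier G" "p l = \<one>\<^bsub>Q\<^esub>"
      using p(2) upper_central_series_subset by blast+
    then have "p (inv (y [^] k) \<otimes> (l \<otimes> a) \<otimes> y [^] k) = p (inv (y [^] k) \<otimes> a \<otimes> y [^] k)"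
      using assms by simp
    then show ?thesis
      using l by (metis imageI)
  qed
  then obtain i j :: nat where ij: "i < j"
    "p (inv (y [^] i) \<otimes> a \<otimes> y [^] i) = p (inv (y [^] j) \<otimes> a \<otimes> y [^] j)"
    using pigeonhole_sequence[of "p ` F" "\<lambda>k. p (inv (y [^] k) \<otimes> a \<otimes> y [^] k)"] assms by blast
  let ?m = "j - i"
  have y: "p (y [^] j) = p (y [^] ?m) \<otimes>\<^bsub>Q\<^esub> p (y [^] i)"
    using ij assms by (simp add: nat_pow_mult flip: p.hom_mult)
  have "p (y [^] j) \<otimes>\<^bsub>Q\<^esub> p (inv (y [^] i) \<otimes> a \<otimes> y [^] i) = p a \<otimes>\<^bsub>Q\<^esub> p (y [^] j)"
    unfolding ij(2) using assms by (simp add: p.H.m_assoc)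
  then have "(p (y [^] ?m) \<otimes>\<^bsub>Q\<^esub> p a) \<otimes>\<^bsub>Q\<^esub> p (y [^] i) = (p a \<otimes>\<^bsub>Q\<^esub> p (y [^] ?m)) \<otimes>\<^bsub>Q\<^esub> p (y [^] i)"
    unfolding y using assms by (simp add: p.H.m_assoc)
  then have "p a \<otimes>\<^bsub>Q\<^esub> p (y [^] ?m) = p (y [^] ?m) \<otimes>\<^bsub>Q\<^esub> p a"
    using assms by (simp add: p.H.right_cancel)
  then have "p (commutator G a (y [^] ?m)) = \<one>\<^bsub>Q\<^esub>"
    using assms by (simp add: p.hom_commutator p.H.commutator_eq_one_iff)
  then have "commutator G a (y [^] ?m) \<in> upper_central_series G n"
    using p(2) assms by simp
  then show ?thesis
    using ij(1) commutator_pow_isolated[OF assms(1-4), of ?m] by simp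
qed

lemma upper_central_series_of_nilpotent:
  assumes "nilpotent G"
  obtains c where "upper_central_series G c = carrier G"
proof -
  obtain n where n: "lower_central_series G n = {\<one>}"
    using assms by (auto simp: nilpotent_def)
  have lcs: "lower_central_series G i \<subseteq> carrier G" for i
  proof (induction i)
    case (Suc i)
    then show ?case
      unfolding lower_central_series.simps by (intro generate_incl) auto
  qed simp
  have "i \<le> n \<Longrightarrow> lower_central_series G (n - i) \<subseteq> upper_central_series G i" for i
  proof (induction i)
    case (Suc i)
    have "commutator G x g \<in> upper_central_series G i"
      if "x \<in> lower_central_series G (n - Suc i)" "g \<in> carrier G" for x g
    proof -
      have "commutator G x g \<in> lower_central_series G (Suc (n - Suc i))"
        unfolding lower_central_series.simps by (rule generate.incl) (use that in blast)
      then show ?thesis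
        using Suc.IH Suc.prems Suc_diff_Suc[of i n] by (metis Suc_leD Suc_le_lessD subsetD)
    qed
    then show ?case
      unfolding upper_central_series.simps using lcs by blast
  qed (simp add: n)
  from this[of n] have "upper_central_series G n = carrier G"
    using upper_central_series_subset[of n] by simp
  then show ?thesis
    using that by blast
qed

end

section \<open>Homomorphisms to the reals\<close>

definition real_hom :: "('a, 'm) monoid_scheme \<Rightarrow> ('a \<Rightarrow> real) \<Rightarrow> bool" where
  "real_hom G \<chi> \<longleftrightarrow> (\<forall>x \<in> carrier G. \<forall>y \<in> carrier G. \<chi> (x \<otimes>\<^bsub>G\<^esub> y) = \<chi> x + \<chi> y)"

text \<open>For a group this is the isolator of the derived subgroup: the elements some positive
  power of which is a product of commutators.\<close>

definition real_kernel :: "('a, 'm) monoid_scheme \<Rightarrow> 'a set" where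
  "real_kernel G = {x \<in> carrier G. \<forall>\<chi>. real_hom G \<chi> \<longrightarrow> \<chi> x = 0}"

context group
begin

lemma real_hom_simps:
  assumes "real_hom G \<chi>"
  shows "\<chi> \<one> = 0"
    and "x \<in> carrier G \<Longrightarrow> \<chi> (inv x) = - \<chi> x"
    and "x \<in> carrier G \<Longrightarrow> y \<in> carrier G \<Longrightarrow> \<chi> (x \<otimes> y) = \<chi> x + \<chi> y"
proof -
  show m: "x \<in> carrier G \<Longrightarrow> y \<in> carrier G \<Longrightarrow> \<chi> (x \<otimes> y) = \<chi> x + \<chi> y" for x y
    using assms by (simp add: real_hom_def)
  show one: "\<chi> \<one> = 0"
    using m[of \<one> \<one>] by simp
  show "x \<in> carrier G \<Longrightarrow> \<chi> (inv x) = - \<chi> x"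
    using m[of x "inv x"] one by simp
qed

lemma real_kernel_normal: "real_kernel G \<lhd> G"
proof -
  have "subgroup (real_kernel G) G"
    by (rule subgroupI) (auto simp: real_kernel_def real_hom_simps)
  moreover have "h \<otimes> x \<otimes> inv h \<in> real_kernel G" if "x \<in> real_kernel G" "h \<in> carrier G" for x h
    using that by (auto simp: real_kernel_def real_hom_simps)
  ultimately show ?thesis
    by (auto simp: normal_inv_iff)
qed

text \<open>A homomorphism to the reals defined on a subgroup that contains \<open>K\<close>, and vanishing on \<open>K\<close>,
  is represented by its graph \<open>r\<close>.\<close>

definition partial_real_hom :: "'a set \<Rightarrow> ('a \<times> real) set \<Rightarrow> bool" where
  "partial_real_hom K r \<longleftrightarrow> r \<subseteq> carrier G \<times> UNIV \<and> K \<times> {0} \<subseteq> r \<and>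
     (\<forall>x v y w. (x, v) \<in> r \<and> (y, w) \<in> r \<longrightarrow> (x \<otimes> y, v + w) \<in> r) \<and>
     (\<forall>x v. (x, v) \<in> r \<longrightarrow> (inv x, - v) \<in> r) \<and>
     (\<forall>x v. (x, v) \<in> r \<and> x \<in> K \<longrightarrow> v = 0)"

lemma partial_real_homD:
  assumes "partial_real_hom K r"
  shows "(x, v) \<in> r \<Longrightarrow> x \<in> carrier G" "x \<in> K \<Longrightarrow> (x, 0) \<in> r"
    "(x, v) \<in> r \<Longrightarrow> (y, w) \<in> r \<Longrightarrow> (x \<otimes> y, v + w) \<in> r"
    "(x, v) \<in> r \<Longrightarrow> (inv x, - v) \<in> r" "(x, v) \<in> r \<Longrightarrow> x \<in> K \<Longrightarrow> v = 0"
  using assms unfolding partial_real_hom_def by blast+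

lemma partial_real_hom_int_pow:
  assumes "partial_real_hom K r" "\<one> \<in> K" "(x, v) \<in> r"
  shows "(x [^] (i::int), of_int i * v) \<in> r"
proof -
  have nat: "(x [^] n, real n * v) \<in> r" for n :: nat
  proof (induction n)
    case 0
    then show ?case
      using partial_real_homD(2)[OF assms(1,2)] by simp
  next
    case (Suc n)
    then show ?case
      using partial_real_homD(3)[OF assms(1) Suc assms(3)] by (simp add: algebra_simps)
  qed
  have x: "x \<in> carrier G"
    using assms partial_real_homD(1) by blast
  show ?thesis
  proof (cases i rule: int_cases2)
    case (nonneg n)
    then show ?thesis
      using nat[of n] by (simp add: int_pow_int)
  next
    case (nonpos n)
    then show ?thesis
      using partial_real_homD(4)[OF assms(1) nat[of n]] x by (simp add: int_pow_neg_int)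
  qed
qed

lemma partial_real_hom_unique:
  assumes "partial_real_hom K r" "\<one> \<in> K" "(x, v) \<in> r" "(x, w) \<in> r"
  shows "v = w"
proof -
  have "(x \<otimes> inv x, v + - w) \<in> r"
    using assms partial_real_homD(3,4) by blast
  then have "(\<one>, v + - w) \<in> r"
    using assms partial_real_homD(1) by fastforce
  then have "v + - w = 0"
    using partial_real_homD(5)[OF assms(1)] assms(2) by blast
  then show ?thesis by simp
qed

text \<open>A value \<open>v\<close> for \<open>s\<close> is admissible when it agrees with the
  values of those powers of \<open>s\<close> that already have one. Commutators lie in
  \<open>K\<close> and have value 0, so powers of \<open>s\<close> can be moved past elements of the
  domain.\<close>

lemma partial_real_hom_extend:
  assumes r: "partial_real_hom K r" and K: "subgroup K G"
    and comm: "\<And>x y. x \<in> carrier G \<Longrightarrow> y \<in> carrier G \<Longrightarrow> commutator G x y \<in> K"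
    and s: "s \<in> carrier G" and v: "\<And>i::int. \<And>w. (s [^] i, w) \<in> r \<Longrightarrow> w = of_int i * v"
  obtains r' where "partial_real_hom K r'" "r \<subseteq> r'" "(s, v) \<in> r'"
proof
  let ?r = "{(x \<otimes> s [^] i, w + of_int i * v) | x w i. (x, w) \<in> r}"
  note rD = partial_real_homD[OF r]
  show sub: "r \<subseteq> ?r"
  proof clarify
    fix x w assume "(x, w) \<in> r"
    then show "\<exists>x' w' i. (x, w) = (x' \<otimes> s [^] (i::int), w' + of_int i * v) \<and> (x', w') \<in> r"
      using rD(1) s by (intro exI[of _ x] exI[of _ w] exI[of _ 0]) auto
  qed
  have "(\<one>, 0) \<in> r"
    using rD(2) K subgroup.one_closed by blast
  then show "(s, v) \<in> ?r"
    using s by (clarify, intro exI[of _ \<one>] exI[of _ 0] exI[of _ 1]) auto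
  show "partial_real_hom K ?r"
    unfolding partial_real_hom_def
  proof (intro conjI allI impI)
    show "?r \<subseteq> carrier G \<times> UNIV"
      using rD(1) s by auto
    show "K \<times> {0} \<subseteq> ?r"
      using sub rD(2) by blast
  next
    fix x1 v1 x2 v2 assume "(x1, v1) \<in> ?r \<and> (x2, v2) \<in> ?r"
    then obtain x i a y j b where eq: "x1 = x \<otimes> s [^] (i::int)" "v1 = a + of_int i * v" "(x, a) \<in> r"
      "x2 = y \<otimes> s [^] (j::int)" "v2 = b + of_int j * v" "(y, b) \<in> r"
      by blast
    let ?k = "commutator G (inv y) (s [^] i)"
    have car: "x \<in> carrier G" "y \<in> carrier G"
      using eq rD(1) by auto
    then have "?k \<in> K"
      using comm s by simp
    then have "(x \<otimes> y \<otimes> ?k, a + b + 0) \<in> r"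
      using rD(2,3) eq by blast
    moreover have "x1 \<otimes> x2 = x \<otimes> y \<otimes> ?k \<otimes> s [^] (i + j)"
      using car s by (simp add: eq(1,4) commutator_def m_assoc int_pow_mult)
    moreover have "v1 + v2 = a + b + 0 + of_int (i + j) * v"
      by (simp add: eq(2,5) algebra_simps)
    ultimately show "(x1 \<otimes> x2, v1 + v2) \<in> ?r"
      by blast
  next
    fix x1 v1 assume "(x1, v1) \<in> ?r"
    then obtain x i a where eq: "x1 = x \<otimes> s [^] (i::int)" "v1 = a + of_int i * v" "(x, a) \<in> r"
      by blast
    let ?k = "commutator G x (s [^] (- i))"
    have car: "x \<in> carrier G"
      using eq rD(1) by auto
    then have "?k \<in> K"
      using comm s by simp
    then have "(inv x \<otimes> ?k, - a + 0) \<in> r"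
      using rD(2-4) eq by blast
    moreover have "inv x1 = inv x \<otimes> ?k \<otimes> s [^] (- i)"
      using car s by (simp add: eq(1) commutator_def m_assoc int_pow_neg inv_mult_group)
    moreover have "- v1 = - a + 0 + of_int (- i) * v"
      by (simp add: eq(2))
    ultimately show "(inv x1, - v1) \<in> ?r"
      by blast
  next
    fix x1 v1 assume A: "(x1, v1) \<in> ?r \<and> x1 \<in> K"
    then obtain x i a where eq: "x1 = x \<otimes> s [^] (i::int)" "v1 = a + of_int i * v" "(x, a) \<in> r"
      by blast
    have car: "x \<in> carrier G"
      using eq rD(1) by auto
    have "(inv x \<otimes> x1, - a + 0) \<in> r"
      using rD(2-4) eq A by blast
    moreover have "inv x \<otimes> x1 = s [^] i"
      using car s by (simp add: eq(1))
    ultimately have "- a + 0 = of_int i * v"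
      using v by metis
    then show "v1 = 0"
      using eq(2) by simp
  qed
qed

text \<open>Divisibility of the reals: the homomorphism sending \<open>a\<close> to 1 and
  \<open>K\<close> to 0 is extended one element at a time, and a maximal extension given by Zorn's
  lemma has full domain.\<close>

lemma exists_real_hom_nonzero:
  assumes K: "subgroup K G"
    and comm: "\<And>x y. x \<in> carrier G \<Longrightarrow> y \<in> carrier G \<Longrightarrow> commutator G x y \<in> K"
    and isolated: "\<And>x k. x \<in> carrier G \<Longrightarrow> 0 < (k::nat) \<Longrightarrow> x [^] k \<in> K \<Longrightarrow> x \<in> K"
    and a: "a \<in> carrier G" "a \<notin> K"
  obtains \<chi> where "real_hom G \<chi>" "\<chi> a \<noteq> 0"
proof -
  have one: "\<one> \<in> K"
    using K subgroup.one_closed by blast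
  have K0: "partial_real_hom K (K \<times> {0})"
    unfolding partial_real_hom_def
    by (auto intro: subgroup.mem_carrier[OF K] subgroup.m_closed[OF K] subgroup.m_inv_closed[OF K])
  \<comment> \<open>Isolation of \<open>K\<close> makes the start consistent: only the zeroth power
    of \<open>a\<close> lies in \<open>K\<close>.\<close>
  have "w = of_int i * 1" if "(a [^] (i::int), w) \<in> K \<times> {0}" for i w
  proof -
    have i: "a [^] i \<in> K" "w = 0"
      using that by auto
    obtain n where n: "i = int n \<or> i = - int n"
      by (meson int_cases2)
    then have "a [^] n \<in> K"
    proof
      assume "i = - int n"
      then have "inv (inv (a [^] n)) \<in> K"
        using i(1) a(1) subgroup.m_inv_closed[OF K] by (metis int_pow_neg_int)
      then show ?thesis
        using a(1) by simp
    qed (use i(1) in \<open>simp add: int_pow_int\<close>)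
    then have "n = 0"
      using isolated[OF a(1)] a(2) by blast
    then show ?thesis
      using n i(2) by auto
  qed
  then obtain r0 where r0: "partial_real_hom K r0" "(a, 1) \<in> r0"
    using partial_real_hom_extend[OF K0 K comm a(1), of 1] by blast
  define \<A> where "\<A> = {r. partial_real_hom K r \<and> (a, 1) \<in> r}"
  have "\<exists>M\<in>\<A>. \<forall>X\<in>\<A>. M \<subseteq> X \<longrightarrow> X = M"
  proof (rule subset_Zorn_nonempty)
    show "\<A> \<noteq> {}"
      using r0 by (auto simp: \<A>_def)
    fix \<C> assume C: "\<C> \<noteq> {}" "subset.chain \<A> \<C>"
    have CA: "partial_real_hom K r \<and> (a, 1) \<in> r" if "r \<in> \<C>" for r
      using C(2) that by (auto simp: \<A>_def subset_chain_def)
    have dir: "\<exists>r\<in>\<C>. p \<in> r \<and> q \<in> r" if pq: "p \<in> \<Union>\<C>" "q \<in> \<Union>\<C>" for p q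
    proof -
      obtain r1 r2 where r12: "r1 \<in> \<C>" "p \<in> r1" "r2 \<in> \<C>" "q \<in> r2"
        using pq by blast
      then have "r1 \<subseteq> r2 \<or> r2 \<subseteq> r1"
        using C(2) by (auto simp: subset_chain_def)
      then show ?thesis
        using r12 by blast
    qed
    have "partial_real_hom K (\<Union>\<C>)"
      unfolding partial_real_hom_def
    proof (intro conjI allI impI)
      show "\<Union>\<C> \<subseteq> carrier G \<times> UNIV"
        using CA unfolding partial_real_hom_def by blast
      show "K \<times> {0} \<subseteq> \<Union>\<C>"
        using CA C(1) unfolding partial_real_hom_def by blast
      show "(x \<otimes> y, v + w) \<in> \<Union>\<C>" if xy: "(x, v) \<in> \<Union>\<C> \<and> (y, w) \<in> \<Union>\<C>" for x v y w
      proof -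
        obtain r where "r \<in> \<C>" "(x, v) \<in> r" "(y, w) \<in> r"
          using dir xy by blast
        then show ?thesis
          using CA partial_real_homD(3)[of K r x v y w] by blast
      qed
      show "(inv x, - v) \<in> \<Union>\<C>" if "(x, v) \<in> \<Union>\<C>" for x v
        using that CA partial_real_homD(4)[of K _ x v] by blast
      show "v = 0" if "(x, v) \<in> \<Union>\<C> \<and> x \<in> K" for x v
        using that CA partial_real_homD(5)[of K _ x v] by blast
    qed
    then show "\<Union>\<C> \<in> \<A>"
      using C(1) CA by (auto simp: \<A>_def)
  qed
  then obtain r where r: "partial_real_hom K r" "(a, 1) \<in> r"
    and max: "\<And>r'. partial_real_hom K r' \<Longrightarrow> r \<subseteq> r' \<Longrightarrow> r' = r"
    unfolding \<A>_def by blast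
  have "\<exists>v. (s, v) \<in> r" if s: "s \<in> carrier G" for s
  proof -
    \<comment> \<open>If \<open>s [^] m\<close> already has the value \<open>u\<close> for some
      \<open>m \<noteq> 0\<close>, then \<open>s\<close> must get \<open>u / m\<close>; otherwise
      the value is free, and 0 is taken.\<close>
    have "\<exists>v. \<forall>(i::int) w. (s [^] i, w) \<in> r \<longrightarrow> w = of_int i * v"
    proof (cases "\<exists>(m::int) u. m \<noteq> 0 \<and> (s [^] m, u) \<in> r")
      case True
      then obtain m :: int and u where m: "m \<noteq> 0" "(s [^] m, u) \<in> r"
        by blast
      have "w = of_int i * (u / of_int m)" if "(s [^] i, w) \<in> r" for i :: int and w
      proof -
        have "(s [^] (m * i), of_int i * u) \<in> r"
          using partial_real_hom_int_pow[OF r(1) one m(2), of i] s by (simp add: int_pow_pow)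
        moreover have "(s [^] (m * i), of_int m * w) \<in> r"
          using partial_real_hom_int_pow[OF r(1) one that, of m] s by (simp add: int_pow_pow mult.commute)
        ultimately have "of_int i * u = of_int m * w"
          using partial_real_hom_unique[OF r(1) one] by blast
        then show ?thesis
          using m(1) by (simp add: field_simps)
      qed
      then show ?thesis by blast
    next
      case False
      have "w = of_int i * 0" if "(s [^] i, w) \<in> r" for i :: int and w
      proof -
        have "i = 0"
          using False that by blast
        then have "(\<one>, w) \<in> r"
          using that by simp
        then show ?thesis
          using partial_real_homD(5)[OF r(1)] one by simp
      qed
      then show ?thesis by blast
    qed
    then obtain v where "\<And>i::int. \<And>w. (s [^] i, w) \<in> r \<Longrightarrow> w = of_int i * v"
      by blast
    then obtain r' where "partial_real_hom K r'" "r \<subseteq> r'" "(s, v) \<in> r'"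
      using partial_real_hom_extend[OF r(1) K comm s] by blast
    then show ?thesis
      using max by blast
  qed
  then obtain \<chi> where \<chi>: "\<And>s. s \<in> carrier G \<Longrightarrow> (s, \<chi> s) \<in> r"
    by metis
  have "\<chi> (x \<otimes> y) = \<chi> x + \<chi> y" if "x \<in> carrier G" "y \<in> carrier G" for x y
    using partial_real_hom_unique[OF r(1) one] partial_real_homD(3)[OF r(1)] \<chi> that by (meson m_closed)
  moreover have "\<chi> a = 1"
    using partial_real_hom_unique[OF r(1) one] \<chi> a r(2) by blast
  ultimately show ?thesis
    using that[of \<chi>] by (simp add: real_hom_def)
qed

section \<open>Upper bounds for the common kernel\<close>

lemma real_kernel_subset_isolated:
  assumes "subgroup K G"
    and "\<And>x y. x \<in> carrier G \<Longrightarrow> y \<in> carrier G \<Longrightarrow> commutator G x y \<in> K"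
    and "\<And>x k. x \<in> carrier G \<Longrightarrow> 0 < (k::nat) \<Longrightarrow> x [^] k \<in> K \<Longrightarrow> x \<in> K"
  shows "real_kernel G \<subseteq> K"
proof
  fix a assume a: "a \<in> real_kernel G"
  show "a \<in> K"
  proof (rule ccontr)
    assume "a \<notin> K"
    moreover have "a \<in> carrier G"
      using a by (simp add: real_kernel_def)
    ultimately obtain \<chi> where "real_hom G \<chi>" "\<chi> a \<noteq> 0"
      using exists_real_hom_nonzero[of K a] assms by blast
    then show False
      using a by (simp add: real_kernel_def)
  qed
qed

lemma real_kernel_abelian:
  assumes "torsion_free G" "upper_central_series G 1 = carrier G"
  shows "real_kernel G = {\<one>}"
proof -
  have "real_kernel G \<subseteq> {\<one>}"
  proof (rule real_kernel_subset_isolated)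
    show "subgroup {\<one>} G"
      by (rule triv_subgroup)
    show "commutator G x y \<in> {\<one>}" if "x \<in> carrier G" "y \<in> carrier G" for x y
      using assms(2) that by auto
    show "x \<in> {\<one>}" if "x \<in> carrier G" "0 < k" "x [^] k \<in> {\<one>}" for x and k :: nat
      using assms(1) that by (auto simp: torsion_free_def)
  qed
  then show ?thesis
    using subgroup.one_closed[OF normal_imp_subgroup[OF real_kernel_normal]] by blast
qed

text \<open>Modulo term \<open>n\<close> the map sending \<open>x\<close> to the commutator of
  \<open>u\<close> and \<open>x\<close> is a homomorphism whose values commute with the image of
  \<open>G\<close>. Its kernel contains all commutators and is isolated, so it contains the real
  kernel.\<close>

lemma commutator_real_kernel:
  assumes tf: "torsion_free G" "upper_central_series G c = carrier G"
    and u: "u \<in> upper_central_series G (Suc (Suc n))" and x: "x \<in> real_kernel G"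
  shows "commutator G u x \<in> upper_central_series G n"
proof -
  obtain Q :: "'a set monoid" and p where p: "group_hom G Q p"
    "\<And>x. x \<in> carrier G \<Longrightarrow> p x = \<one>\<^bsub>Q\<^esub> \<longleftrightarrow> x \<in> upper_central_series G n"
    using upper_central_series_quotient by blast
  interpret p: group_hom G Q p by (rule p)
  have uc: "u \<in> carrier G"
    using u by simp
  let ?t = "\<lambda>x. p (commutator G u x)"
  have central: "?t x \<otimes>\<^bsub>Q\<^esub> p y = p y \<otimes>\<^bsub>Q\<^esub> ?t x" if "x \<in> carrier G" "y \<in> carrier G" for x y
  proof -
    have "commutator G u x \<in> upper_central_series G (Suc n)"
      using u that commutator_in_upper_central_series by blast
    then have "commutator G (commutator G u x) y \<in> upper_central_series G n"
      using that by simp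
    then show ?thesis
      using p(2)[of "commutator G (commutator G u x) y"] that uc
      by (simp add: p.hom_commutator p.H.commutator_eq_one_iff)
  qed
  have "?t \<in> hom G Q"
  proof (rule homI)
    fix x y assume xy: "x \<in> carrier G" "y \<in> carrier G"
    have "commutator G u (x \<otimes> y) = commutator G u x \<otimes> (x \<otimes> commutator G u y \<otimes> inv x)"
      using xy uc by (simp add: commutator_def m_assoc inv_mult_group)
    then have "?t (x \<otimes> y) = ?t x \<otimes>\<^bsub>Q\<^esub> (p x \<otimes>\<^bsub>Q\<^esub> ?t y \<otimes>\<^bsub>Q\<^esub> inv\<^bsub>Q\<^esub> p x)"
      using xy uc by simp
    also have "p x \<otimes>\<^bsub>Q\<^esub> ?t y \<otimes>\<^bsub>Q\<^esub> inv\<^bsub>Q\<^esub> p x = ?t y \<otimes>\<^bsub>Q\<^esub> p x \<otimes>\<^bsub>Q\<^esub> inv\<^bsub>Q\<^esub> p x"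
      using central[OF xy(2,1)] by simp
    also have "\<dots> = ?t y"
      using xy uc by (simp add: p.H.m_assoc)
    finally show "?t (x \<otimes> y) = ?t x \<otimes>\<^bsub>Q\<^esub> ?t y" .
  qed (use uc in simp)
  then interpret t: group_hom G Q ?t
    by (simp add: group_hom_def group_hom_axioms_def)
  have "real_kernel G \<subseteq> kernel G Q ?t"
  proof (rule real_kernel_subset_isolated)
    show "subgroup (kernel G Q ?t) G"
      by (rule t.subgroup_kernel)
    show "commutator G x y \<in> kernel G Q ?t" if "x \<in> carrier G" "y \<in> carrier G" for x y
    proof -
      have "?t x \<otimes>\<^bsub>Q\<^esub> ?t y = ?t y \<otimes>\<^bsub>Q\<^esub> ?t x"
        using central[of x "commutator G u y"] that uc by simp
      then have "commutator Q (?t x) (?t y) = \<one>\<^bsub>Q\<^esub>"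
        using that uc by (simp add: p.H.commutator_eq_one_iff)
      then show ?thesis
        using that by (simp add: kernel_def t.hom_commutator)
    qed
    show "x \<in> kernel G Q ?t" if "x \<in> carrier G" "0 < k" "x [^] k \<in> kernel G Q ?t" for x and k :: nat
    proof -
      have "commutator G u (x [^] k) \<in> upper_central_series G n"
        using that p(2) uc by (simp add: kernel_def)
      then have "commutator G u x \<in> upper_central_series G n"
        using commutator_pow_isolated[OF tf uc that(1,2)] by blast
      then show ?thesis
        using that p(2) uc by (simp add: kernel_def)
    qed
  qed
  then have "?t x = \<one>\<^bsub>Q\<^esub>" "x \<in> carrier G"
    using x by (auto simp: kernel_def)
  then show ?thesis
    using p(2) uc by simp
qed

end

section \<open>Harmonic functions\<close>

text \<open>The \<open>R n\<close> are the connection sets of a family of Cayley graphs used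
  simultaneously. No relation between different \<open>R n\<close> is imposed, so that intersecting
  all of them with a subgroup gives such a family again.\<close>

locale filtered_group = group G for G (structure) +
  fixes R :: "nat \<Rightarrow> 'a set"
  assumes R_subset: "R n \<subseteq> carrier G"
    and R_finite: "finite (R n)"
    and R_inv: "x \<in> R n \<Longrightarrow> inv x \<in> R n"
    and R_cover: "x \<in> carrier G \<Longrightarrow> \<exists>n. x \<in> R n"
begin

definition harmonic :: "('a \<Rightarrow> real) \<Rightarrow> bool" where
  "harmonic f \<longleftrightarrow> (\<forall>n. \<forall>x \<in> carrier G. (\<Sum>s\<in>R n. f (x \<otimes> s) - f x) = 0)"

text \<open>A maximum principle: if the increment \<open>D\<close> had a positive supremum
  \<open>M\<close>, harmonicity would keep \<open>D\<close> close to \<open>M\<close> along many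
  steps \<open>x \<otimes> c [^] j\<close>, and \<open>f\<close> would grow there beyond its
  bound.\<close>

lemma harmonic_increment_nonpos:
  assumes bounded: "\<And>x. x \<in> carrier G \<Longrightarrow> \<bar>f x\<bar> \<le> C"
    and c: "c \<in> carrier G" and harm: "harmonic (\<lambda>x. f (x \<otimes> c) - f x)"
    and x0: "x0 \<in> carrier G"
  shows "f (x0 \<otimes> c) \<le> f x0"
proof (rule ccontr)
  define D where "D x = f (x \<otimes> c) - f x" for x
  assume "\<not> ?thesis"
  then have D0: "D x0 > 0"
    by (simp add: D_def)
  have bdd: "bdd_above (D ` carrier G)"
  proof (rule bdd_aboveI2)
    fix x assume x: "x \<in> carrier G"
    show "D x \<le> 2 * C"
      using bounded[OF x] bounded[of "x \<otimes> c"] x c by (simp add: D_def)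
  qed
  define M where "M = Sup (D ` carrier G)"
  have D_le: "D x \<le> M" if "x \<in> carrier G" for x
    unfolding M_def using bdd that by (simp add: cSUP_upper)
  then have "M > 0"
    using D0 x0 by force
  obtain n where n: "c \<in> R n"
    using R_cover c by blast
  define r where "r = real (card (R n))"
  have "card (R n) > 0"
    using n R_finite card_gt_0_iff by blast
  then have r: "r \<ge> 1"
    by (simp add: r_def)
  \<comment> \<open>\<open>J\<close> steps of size at least \<open>M / 2\<close> raise
    \<open>f\<close> by more than \<open>2 * C\<close>. The gap to \<open>M\<close> grows at most by
    the factor \<open>r\<close> per step, so a gap below \<open>e\<close> at the start stays at most
    \<open>M / 2\<close>.\<close>
  obtain J where J: "real J * M > 4 * C"
    using reals_Archimedean3[OF \<open>M > 0\<close>] by blast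
  define e where "e = M / (2 * r ^ J)"
  have "e > 0"
    using \<open>M > 0\<close> r by (simp add: e_def)
  then have "M - e < Sup (D ` carrier G)"
    by (simp add: M_def)
  then obtain x where x: "x \<in> carrier G" "D x > M - e"
    using less_cSupD[of "D ` carrier G"] x0 by blast
  \<comment> \<open>The gaps \<open>M - D (y \<otimes> s)\<close> are nonnegative and by harmonicity
    add up to \<open>r * (M - D y)\<close>, which therefore bounds the one for
    \<open>s = c\<close>.\<close>
  have step: "M - D (y \<otimes> c) \<le> r * (M - D y)" if y: "y \<in> carrier G" for y
  proof -
    have "M - D (y \<otimes> c) \<le> (\<Sum>s\<in>R n. M - D (y \<otimes> s))"
      by (rule member_le_sum[OF n, of "\<lambda>s. M - D (y \<otimes> s)"])
        (use R_subset D_le y R_finite in \<open>auto simp: subset_iff\<close>)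
    also have "\<dots> = r * (M - D y) - (\<Sum>s\<in>R n. D (y \<otimes> s) - D y)"
      by (simp add: r_def sum_subtractf algebra_simps)
    also have "(\<Sum>s\<in>R n. D (y \<otimes> s) - D y) = 0"
      using harm y unfolding harmonic_def D_def by blast
    finally show ?thesis by simp
  qed
  have close: "M - D (x \<otimes> c [^] j) \<le> r ^ j * e" for j :: nat
  proof (induction j)
    case 0
    show ?case
      using x by simp
  next
    case (Suc j)
    have "M - D (x \<otimes> c [^] Suc j) \<le> r * (M - D (x \<otimes> c [^] j))"
      using step[of "x \<otimes> c [^] j"] x c by (simp add: m_assoc)
    also have "\<dots> \<le> r * (r ^ j * e)"
      using Suc r by (intro mult_left_mono) auto
    finally show ?case
      by simp
  qed
  have "f (x \<otimes> c [^] j) \<ge> f x + real j * (M / 2)" if "j \<le> J" for j :: nat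
    using that
  proof (induction j)
    case 0
    show ?case
      using x by simp
  next
    case (Suc j)
    have "r ^ j * e \<le> r ^ J * e"
      using r \<open>e > 0\<close> Suc.prems by (intro mult_right_mono power_increasing) auto
    also have "\<dots> = M / 2"
      using r by (simp add: e_def)
    finally have "D (x \<otimes> c [^] j) \<ge> M / 2"
      using close[of j] by simp
    then have "f (x \<otimes> c [^] Suc j) \<ge> f (x \<otimes> c [^] j) + M / 2"
      using x c by (simp add: D_def m_assoc)
    moreover have "f x + real j * (M / 2) \<le> f (x \<otimes> c [^] j)"
      using Suc by simp
    moreover have "real (Suc j) * (M / 2) = real j * (M / 2) + M / 2"
      by (simp add: field_simps)
    ultimately show ?case
      by linarith
  qed
  from this[of J] have "f (x \<otimes> c [^] J) - f x > 2 * C"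
    using J by simp
  then show False
    using bounded[OF x(1)] bounded[of "x \<otimes> c [^] J"] x c by auto
qed

section \<open>Harmonic functions along the upper central series\<close>

lemma move_right:
  assumes "c \<in> carrier G" "y \<in> carrier G"
  shows "c \<otimes> y = y \<otimes> c \<otimes> commutator G (inv c) (inv y)"
  using assms by (simp add: commutator_def m_assoc)

text \<open>Harmonicity is about right multiplication, so right translates of harmonic functions
  need not be harmonic; the one by \<open>c\<close> is, as soon as \<open>c\<close> may be
  interchanged with the steps \<open>s\<close>.\<close>

lemma harmonic_increment:
  assumes f: "harmonic f" and c: "c \<in> carrier G"
    and swap: "\<And>x s. x \<in> carrier G \<Longrightarrow> s \<in> carrier G \<Longrightarrow> f (x \<otimes> c \<otimes> s) = f (x \<otimes> s \<otimes> c)"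
  shows "harmonic (\<lambda>x. f (x \<otimes> c) - f x)"
  unfolding harmonic_def
proof (intro allI ballI)
  fix n x assume x: "x \<in> carrier G"
  have "(\<Sum>s\<in>R n. f (x \<otimes> s \<otimes> c) - f (x \<otimes> s) - (f (x \<otimes> c) - f x)) =
      (\<Sum>s\<in>R n. (f (x \<otimes> c \<otimes> s) - f (x \<otimes> c)) - (f (x \<otimes> s) - f x))"
    using swap x R_subset by (intro sum.cong) (auto simp: subset_iff)
  also have "\<dots> = 0"
    using f x c unfolding sum_subtractf[of "\<lambda>s. f (x \<otimes> c \<otimes> s) - f (x \<otimes> c)"] harmonic_def by simp
  finally show "(\<Sum>s\<in>R n. f (x \<otimes> s \<otimes> c) - f (x \<otimes> s) - (f (x \<otimes> c) - f x)) = 0" .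
qed

lemma harmonic_uminus: "harmonic f \<Longrightarrow> harmonic (\<lambda>x. - f x)"
  unfolding harmonic_def
proof (intro allI ballI)
  fix n x assume "\<forall>n. \<forall>x\<in>carrier G. (\<Sum>s\<in>R n. f (x \<otimes> s) - f x) = 0" "x \<in> carrier G"
  then have "- (\<Sum>s\<in>R n. f (x \<otimes> s) - f x) = 0"
    by simp
  then show "(\<Sum>s\<in>R n. - f (x \<otimes> s) - - f x) = 0"
    unfolding sum_negf[symmetric] by simp
qed

text \<open>Interchanging \<open>c\<close> from term \<open>i + 1\<close> with \<open>s\<close>
  costs a commutator in term \<open>i\<close>, which \<open>f\<close> does not see by induction. So
  the increment along \<open>c\<close> is harmonic, and the maximum principle for \<open>f\<close>
  and for its negative makes it vanish.\<close>

lemma bounded_harmonic_constant: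
  assumes nil: "upper_central_series G k = carrier G" and f: "harmonic f"
    and bounded: "\<And>x. x \<in> carrier G \<Longrightarrow> \<bar>f x\<bar> \<le> C"
    and "x \<in> carrier G" "c \<in> carrier G"
  shows "f (x \<otimes> c) = f x"
proof -
  have "\<forall>c \<in> upper_central_series G i. \<forall>x \<in> carrier G. f (x \<otimes> c) = f x" for i
  proof (induction i)
    case (Suc i)
    show ?case
    proof
      fix c assume c: "c \<in> upper_central_series G (Suc i)"
      then have cc: "c \<in> carrier G" by simp
      have swap: "f (x \<otimes> c \<otimes> s) = f (x \<otimes> s \<otimes> c)" if x: "x \<in> carrier G" and s: "s \<in> carrier G" for x s
      proof -
        let ?k = "commutator G (inv c) (inv s)"
        have "inv c \<in> upper_central_series G (Suc i)"
          using c subgroup.m_inv_closed[OF upper_central_series_subgroup] by blast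
        then have "?k \<in> upper_central_series G i"
          using commutator_in_upper_central_series s by blast
        moreover have "x \<otimes> c \<otimes> s = x \<otimes> s \<otimes> c \<otimes> ?k"
          using move_right[OF cc s] x s cc by (simp add: m_assoc)
        ultimately show ?thesis
          using Suc.IH x s cc by simp
      qed
      note harm = harmonic_increment[OF f cc swap]
      have "f (x \<otimes> c) \<le> f x" if "x \<in> carrier G" for x
        using harmonic_increment_nonpos[OF bounded cc harm that] .
      moreover have "- f (x \<otimes> c) \<le> - f x" if "x \<in> carrier G" for x
      proof (rule harmonic_increment_nonpos[where f = "\<lambda>x. - f x", OF _ cc _ that])
        show "\<bar>- f y\<bar> \<le> C" if "y \<in> carrier G" for y
          using bounded[OF that] by simp
        show "harmonic (\<lambda>x. - f (x \<otimes> c) - - f x)"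
          using harmonic_uminus[OF harm] by simp
      qed
      ultimately show "\<forall>x \<in> carrier G. f (x \<otimes> c) = f x"
        by (force intro: antisym)
    qed
  qed simp
  moreover have "c \<in> upper_central_series G k"
    using assms by simp
  ultimately show ?thesis
    using \<open>x \<in> carrier G\<close> by blast
qed

lemma bounded_by_linear_imp_zero:
  fixes l B :: real
  assumes "\<And>n::nat. real n * real n * \<bar>l\<bar> \<le> real n * B"
  shows "l = 0"
proof (rule ccontr)
  assume "l \<noteq> 0"
  then obtain n :: nat where n: "real n * \<bar>l\<bar> > \<bar>B\<bar>"
    using reals_Archimedean3[of "\<bar>l\<bar>"] by auto
  then have "real n > 0"
    by (cases "n = 0") auto
  moreover have "real n * (real n * \<bar>l\<bar>) \<le> real n * B"
    using assms[of n] by (simp add: mult.assoc)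
  ultimately have "real n * \<bar>l\<bar> \<le> B"
    by simp
  then show False
    using n by simp
qed

lemma lipschitz_pow:
  assumes L: "\<And>x. x \<in> carrier G \<Longrightarrow> \<bar>f (x \<otimes> y) - f x\<bar> \<le> (L::real)" and "y \<in> carrier G" "x \<in> carrier G"
  shows "\<bar>f (x \<otimes> y [^] (n::nat)) - f x\<bar> \<le> real n * L"
proof (induction n)
  case 0
  then show ?case using assms by simp
next
  case (Suc n)
  then show ?case
    using L[of "x \<otimes> y [^] n"] assms(2,3) by (simp add: m_assoc algebra_simps)
qed

text \<open>Moving \<open>c\<^sup>n\<close> past \<open>y\<^sup>n\<close> changes \<open>f\<close> by \<open>n\<^sup>2\<close> times a constant, whereas \<open>f\<close> grows linearly along
  \<open>c\<^sup>n y\<^sup>n\<close>; this is why a Lipschitz function cannot see commutators.\<close>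

lemma lipschitz_swap_constant_zero:
  assumes swap: "\<And>g h. g \<in> carrier G \<Longrightarrow> h \<in> carrier G \<Longrightarrow>
      f (g \<otimes> c \<otimes> y \<otimes> h) = f (g \<otimes> y \<otimes> c \<otimes> h) + (l::real)"
    and c: "c \<in> carrier G" and y: "y \<in> carrier G"
    and lip: "\<And>y. y \<in> carrier G \<Longrightarrow> \<exists>L. \<forall>x \<in> carrier G. \<bar>f (x \<otimes> y) - f x\<bar> \<le> L"
  shows "l = 0"
proof -
  have swap1: "f (g \<otimes> c \<otimes> y [^] m \<otimes> h) = f (g \<otimes> y [^] m \<otimes> c \<otimes> h) + real m * l"
    if "g \<in> carrier G" "h \<in> carrier G" for m :: nat and g h
    using that
  proof (induction m arbitrary: h)
    case (Suc m)
    have "f (g \<otimes> c \<otimes> y [^] Suc m \<otimes> h) = f (g \<otimes> c \<otimes> y [^] m \<otimes> (y \<otimes> h))"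
      using Suc.prems c y by (simp add: m_assoc)
    also have "\<dots> = f (g \<otimes> y [^] m \<otimes> c \<otimes> (y \<otimes> h)) + real m * l"
      using Suc y by simp
    also have "f (g \<otimes> y [^] m \<otimes> c \<otimes> (y \<otimes> h)) = f (g \<otimes> y [^] m \<otimes> y \<otimes> c \<otimes> h) + l"
      using swap[of "g \<otimes> y [^] m" h] Suc.prems c y by (simp add: m_assoc)
    finally show ?case
      using Suc.prems c y by (simp add: m_assoc algebra_simps)
  qed (use c in simp)
  have swap2: "f (g \<otimes> c [^] n \<otimes> y [^] m) = f (g \<otimes> y [^] m \<otimes> c [^] n) + real n * real m * l"
    if "g \<in> carrier G" for n m :: nat and g
    using that
  proof (induction n arbitrary: g)
    case (Suc n)
    have cs: "c [^] Suc n = c \<otimes> c [^] n"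
      by (rule nat_pow_Suc2[OF c])
    have "f (g \<otimes> c [^] Suc n \<otimes> y [^] m) = f (g \<otimes> c \<otimes> c [^] n \<otimes> y [^] m)"
      unfolding cs using Suc.prems c y by (simp add: m_assoc)
    also have "\<dots> = f (g \<otimes> c \<otimes> y [^] m \<otimes> c [^] n) + real n * real m * l"
      using Suc c by simp
    also have "f (g \<otimes> c \<otimes> y [^] m \<otimes> c [^] n) = f (g \<otimes> y [^] m \<otimes> c \<otimes> c [^] n) + real m * l"
      using swap1 Suc.prems c by simp
    also have "g \<otimes> y [^] m \<otimes> c \<otimes> c [^] n = g \<otimes> y [^] m \<otimes> c [^] Suc n"
      unfolding cs using Suc.prems c y by (simp add: m_assoc)
    finally show ?case
      by (simp add: algebra_simps)
  qed (use y in simp)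
  obtain L M where L: "\<And>x. x \<in> carrier G \<Longrightarrow> \<bar>f (x \<otimes> c) - f x\<bar> \<le> L"
    and M: "\<And>x. x \<in> carrier G \<Longrightarrow> \<bar>f (x \<otimes> y) - f x\<bar> \<le> M"
    using lip[OF c] lip[OF y] by blast
  have "real n * real n * \<bar>l\<bar> \<le> real n * (2 * (L + M))" for n :: nat
  proof -
    note LM = lipschitz_pow[of f c L, OF L c] lipschitz_pow[of f y M, OF M y]
    have "\<bar>f (c [^] n \<otimes> y [^] n) - f \<one>\<bar> \<le> real n * L + real n * M"
      using LM(1)[of \<one> n] LM(2)[of "c [^] n" n] c by simp
    moreover have "\<bar>f (y [^] n \<otimes> c [^] n) - f \<one>\<bar> \<le> real n * L + real n * M"
      using LM(2)[of \<one> n] LM(1)[of "y [^] n" n] y by simp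
    moreover have "f (c [^] n \<otimes> y [^] n) = f (y [^] n \<otimes> c [^] n) + real n * real n * l"
      using swap2[of \<one> n n] c y by simp
    ultimately have "\<bar>real n * real n * l\<bar> \<le> real n * (2 * (L + M))"
      by (simp add: algebra_simps)
    then show ?thesis
      by (simp add: abs_mult)
  qed
  then show ?thesis
    by (rule bounded_by_linear_imp_zero)
qed

text \<open>Interchanging \<open>c\<close> from term \<open>i + 1\<close> with \<open>y\<close>
  costs a commutator in term \<open>i\<close>, hence a constant \<open>l\<close>, which is 0 by
  comparing quadratic with linear growth. The increment of \<open>f\<close> along \<open>c\<close>
  is then harmonic and bounded, so it is constant. The second conjunct of the induction claim moves
  the commutator to the right end, where its constant can be read off.\<close>

lemma lipschitz_harmonic_affine:
  assumes nil: "upper_central_series G k = carrier G" and f: "harmonic f"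
    and lip: "\<And>y. y \<in> carrier G \<Longrightarrow> \<exists>L. \<forall>x \<in> carrier G. \<bar>f (x \<otimes> y) - f x\<bar> \<le> L"
    and "x \<in> carrier G" "y \<in> carrier G"
  shows "f (x \<otimes> y) = f x + f y - f \<one>"
proof -
  have "\<forall>c \<in> upper_central_series G i. (\<exists>l. \<forall>x \<in> carrier G. f (x \<otimes> c) = f x + l) \<and>
      (\<forall>g \<in> carrier G. \<forall>h \<in> carrier G. f (g \<otimes> c \<otimes> h) = f (g \<otimes> h \<otimes> c))" for i
  proof (induction i)
    case 0
    show ?case
      by (auto intro!: exI[of _ 0])
  next
    case (Suc i)
    show ?case
    proof
      fix c assume c: "c \<in> upper_central_series G (Suc i)"
      then have cc: "c \<in> carrier G" by simp
      have swap: "f (g \<otimes> c \<otimes> y) = f (g \<otimes> y \<otimes> c)" if g: "g \<in> carrier G" and y: "y \<in> carrier G" for g y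
      proof -
        let ?k = "commutator G (inv c) (inv y)"
        have "inv c \<in> upper_central_series G (Suc i)"
          using c subgroup.m_inv_closed[OF upper_central_series_subgroup] by blast
        then have k: "?k \<in> upper_central_series G i"
          using commutator_in_upper_central_series y by blast
        then obtain l where l: "\<And>x. x \<in> carrier G \<Longrightarrow> f (x \<otimes> ?k) = f x + l"
          using Suc.IH by blast
        have sw: "f (g \<otimes> c \<otimes> y \<otimes> h) = f (g \<otimes> y \<otimes> c \<otimes> h) + l"
          if "g \<in> carrier G" "h \<in> carrier G" for g h
        proof -
          have "g \<otimes> c \<otimes> y \<otimes> h = (g \<otimes> y \<otimes> c) \<otimes> ?k \<otimes> h"
            using move_right[OF cc y] that y cc by (simp add: m_assoc)
          also have "f \<dots> = f ((g \<otimes> y \<otimes> c) \<otimes> h \<otimes> ?k)"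
            using Suc.IH k that y cc by simp
          finally show ?thesis
            using l that y cc by simp
        qed
        then have "l = 0"
          using lipschitz_swap_constant_zero[OF _ cc y lip] by blast
        then show ?thesis
          using sw[of g \<one>] g y cc by simp
      qed
      obtain L where L: "\<And>x. x \<in> carrier G \<Longrightarrow> \<bar>f (x \<otimes> c) - f x\<bar> \<le> L"
        using lip[OF cc] by blast
      have "f (x \<otimes> c) - f x = f (\<one> \<otimes> c) - f \<one>" if "x \<in> carrier G" for x
        using bounded_harmonic_constant[OF nil harmonic_increment[OF f cc swap] L, of \<one> x] that by simp
      then have "\<exists>l. \<forall>x \<in> carrier G. f (x \<otimes> c) = f x + l"
        by (metis add.commute diff_add_cancel)
      then show "(\<exists>l. \<forall>x \<in> carrier G. f (x \<otimes> c) = f x + l) \<and>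
          (\<forall>g \<in> carrier G. \<forall>h \<in> carrier G. f (g \<otimes> c \<otimes> h) = f (g \<otimes> h \<otimes> c))"
        using swap by blast
    qed
  qed
  moreover have "y \<in> upper_central_series G k"
    using assms by simp
  ultimately obtain l where l: "\<And>x. x \<in> carrier G \<Longrightarrow> f (x \<otimes> y) = f x + l"
    by blast
  show ?thesis
    using l[of x] l[of \<one>] assms by simp
qed

text \<open>Pairing \<open>s\<close> with \<open>inv s\<close>. As the increment of
  \<open>\<chi>\<close> along \<open>s\<close> is \<open>\<chi> s\<close>, this says that
  \<open>\<chi>\<close> is harmonic.\<close>

lemma real_hom_sum_zero:
  assumes "real_hom G \<chi>"
  shows "(\<Sum>s\<in>R n. \<chi> s) = 0"
proof -
  have car: "s \<in> carrier G" if "s \<in> R n" for s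
    using R_subset that by blast
  have "(\<Sum>s\<in>R n. \<chi> s) = (\<Sum>s\<in>R n. \<chi> (inv s))"
    by (rule sum.reindex_bij_witness[where i = "\<lambda>s. inv s" and j = "\<lambda>s. inv s"]) (auto simp: R_inv car)
  also have "\<dots> = (\<Sum>s\<in>R n. - \<chi> s)"
    by (rule sum.cong) (auto simp: real_hom_simps[OF assms] car)
  finally show ?thesis
    by (simp add: sum_negf)
qed

end

section \<open>Isomorphisms of filtered groups\<close>

context group
begin

lemma commutator_subgroup:
  assumes "subgroup H G" "x \<in> H" "y \<in> H"
  shows "commutator (G\<lparr>carrier := H\<rparr>) x y = commutator G x y"
  using assms by (simp add: commutator_def)

lemma commutator_in_subgroup:
  assumes "subgroup H G" "x \<in> H" "y \<in> H"
  shows "commutator G x y \<in> H"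
  using assms by (simp add: commutator_def subgroup.m_closed subgroup.m_inv_closed)

lemma commutator_in_normal:
  assumes "N \<lhd> G" "x \<in> N" "g \<in> carrier G"
  shows "commutator G g x \<in> N"
proof -
  interpret normal N G by fact
  show ?thesis
    using inv_op_closed2[OF assms(3,2)] m_inv_closed[OF assms(2)] assms(2) by (simp add: commutator_def)
qed

lemma torsion_free_subgroup:
  assumes "torsion_free G" "subgroup H G"
  shows "torsion_free (G\<lparr>carrier := H\<rparr>)"
  using assms unfolding torsion_free_def
  by (auto simp: nat_pow_consistent[symmetric] subgroup.mem_carrier)

text \<open>By \<open>commutator_real_kernel\<close>, the intersection of the real kernel with term
  \<open>j + 2\<close> of \<open>G\<close> lies in term \<open>j + 1\<close> of the real kernel. The
  index is gained in the base case, since term 2 of \<open>G\<close> commutes with the real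
  kernel.\<close>

lemma upper_central_series_real_kernel:
  assumes tf: "torsion_free G" and nil: "upper_central_series G (Suc (Suc c)) = carrier G"
  shows "upper_central_series (G\<lparr>carrier := real_kernel G\<rparr>) (Suc c) = real_kernel G"
proof -
  let ?N = "real_kernel G" and ?H = "G\<lparr>carrier := real_kernel G\<rparr>"
  have N: "subgroup ?N G"
    using real_kernel_normal normal_imp_subgroup by blast
  interpret H: group ?H
    using subgroup.subgroup_is_group[OF N group_axioms] .
  have "?N \<inter> upper_central_series G (Suc (Suc j)) \<subseteq> upper_central_series ?H (Suc j)" for j
  proof (induction j)
    case 0
    have "commutator ?H u g = \<one>" if "u \<in> ?N" "u \<in> upper_central_series G (Suc (Suc 0))" "g \<in> ?N" for u g
      using commutator_real_kernel[OF tf nil that(2,3)] commutator_subgroup[OF N that(1,3)] by simp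
    then show ?case
      unfolding upper_central_series.simps(2)[of ?H] by auto
  next
    case (Suc j)
    have "commutator ?H u g \<in> upper_central_series ?H (Suc j)"
      if "u \<in> ?N" "u \<in> upper_central_series G (Suc (Suc (Suc j)))" "g \<in> ?N" for u g
    proof -
      have "commutator G u g \<in> upper_central_series G (Suc j)"
        using commutator_real_kernel[OF tf nil that(2,3)] .
      then have "commutator G u g \<in> upper_central_series G (Suc (Suc j))"
        using upper_central_series_Suc_mono by blast
      then show ?thesis
        using Suc.IH commutator_subgroup[OF N that(1,3)] commutator_in_subgroup[OF N that(1,3)] by auto
    qed
    then show ?case
      unfolding upper_central_series.simps(2)[of ?H "Suc j"] by auto
  qed
  from this[of c] have "?N \<subseteq> upper_central_series ?H (Suc c)"
    using subgroup.subset[OF N] nil by blast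
  then show ?thesis
    using H.upper_central_series_subset[of "Suc c"] by auto
qed

text \<open>The difference \<open>f\<close> obeys a twisted product rule: its value at a product is
  \<open>f m\<close>, conjugated by \<open>\<alpha> m'\<close>, times \<open>f m'\<close>. Hence the
  conjugates of \<open>f m\<close> by powers of \<open>\<alpha> m'\<close> lie in a finite set,
  \<open>f m\<close> commutes with \<open>\<alpha> m'\<close>, and \<open>f\<close> is a
  homomorphism with finite image in a torsion-free group.\<close>

lemma homs_eq_if_finite_difference:
  assumes tf: "torsion_free G" "upper_central_series G c = carrier G"
    and "group H" and \<alpha>: "\<alpha> \<in> hom H G" and \<beta>: "\<beta> \<in> hom H G" and "finite F"
    and F: "\<And>m. m \<in> carrier H \<Longrightarrow> inv (\<alpha> m) \<otimes> \<beta> m \<in> F" and m: "m \<in> carrier H"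
  shows "\<alpha> m = \<beta> m"
proof -
  interpret a: group_hom H G \<alpha>
    using assms group_axioms by (simp add: group_hom_def group_hom_axioms_def)
  interpret b: group_hom H G \<beta>
    using assms group_axioms by (simp add: group_hom_def group_hom_axioms_def)
  define f where "f m = inv (\<alpha> m) \<otimes> \<beta> m" for m
  have f_closed: "f m \<in> carrier G" if "m \<in> carrier H" for m
    using that by (simp add: f_def)
  have f_mult: "f (m \<otimes>\<^bsub>H\<^esub> m') = inv (\<alpha> m') \<otimes> f m \<otimes> \<alpha> m' \<otimes> f m'"
    if "m \<in> carrier H" "m' \<in> carrier H" for m m'
    using that by (simp add: f_def m_assoc inv_mult_group)
  define E where "E = (\<lambda>(a, b). a \<otimes> inv b) ` (F \<times> F)"
  have E: "finite E"
    using \<open>finite F\<close> by (simp add: E_def)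
  have comm: "commutator G (f m) (\<alpha> m') = \<one>" if mm: "m \<in> carrier H" "m' \<in> carrier H" for m m'
  proof -
    have "inv (\<alpha> m' [^] k) \<otimes> (\<one> \<otimes> f m) \<otimes> \<alpha> m' [^] k \<in> E" for k :: nat
    proof -
      let ?n = "m' [^]\<^bsub>H\<^esub> k"
      have n: "?n \<in> carrier H"
        using mm by simp
      have "inv (\<alpha> ?n) \<otimes> f m \<otimes> \<alpha> ?n = f (m \<otimes>\<^bsub>H\<^esub> ?n) \<otimes> inv (f ?n)"
        using f_mult[OF mm(1) n] f_closed mm n by (simp add: m_assoc)
      moreover have "f (m \<otimes>\<^bsub>H\<^esub> ?n) \<in> F" "f ?n \<in> F"
        using F mm n by (simp_all add: f_def del: a.hom_mult b.hom_mult)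
      ultimately have "inv (\<alpha> ?n) \<otimes> f m \<otimes> \<alpha> ?n \<in> E"
        unfolding E_def by force
      then show ?thesis
        using mm f_closed by (simp add: a.hom_nat_pow)
    qed
    then have "commutator G (f m) (\<alpha> m') \<in> upper_central_series G 0"
      using commutator_mem_if_finite_conjugates[OF tf f_closed[OF mm(1)] a.hom_closed[OF mm(2)] E, of 0]
      by auto
    then show ?thesis by simp
  qed
  have f_hom: "f (m \<otimes>\<^bsub>H\<^esub> m') = f m \<otimes> f m'" if mm: "m \<in> carrier H" "m' \<in> carrier H" for m m'
  proof -
    have "f m \<otimes> \<alpha> m' = \<alpha> m' \<otimes> f m"
      using comm[OF mm] mm f_closed commutator_eq_one_iff by simp
    then have "inv (\<alpha> m') \<otimes> f m \<otimes> \<alpha> m' = f m"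
      using mm f_closed by (simp add: m_assoc)
    then show ?thesis
      using f_mult[OF mm] by simp
  qed
  have f_pow: "f (m [^]\<^bsub>H\<^esub> k) = f m [^] k" for k :: nat
  proof (induction k)
    case 0
    show ?case by (simp add: f_def)
  next
    case (Suc k)
    then show ?case
      using f_hom m by simp
  qed
  have "f m [^] k \<in> F" for k :: nat
    using F[of "m [^]\<^bsub>H\<^esub> k"] m by (simp flip: f_pow) (simp add: f_def)
  then obtain i j :: nat where ij: "i < j" "f m [^] i = f m [^] j"
    using pigeonhole_sequence[OF \<open>finite F\<close>] by metis
  then have "f m [^] (j - i) = \<one>"
    using pow_eq_pow_imp_one f_closed m by blast
  then have "f m = \<one>"
    using tf(1) ij(1) f_closed m unfolding torsion_free_def by (meson zero_less_diff)
  then show ?thesis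
    using m by (metis a.hom_closed b.hom_closed f_def inv_cancel_left(2) r_one)
qed

end

lemma (in filtered_group) subgroup_filtered:
  assumes "subgroup H G"
  shows "filtered_group (G\<lparr>carrier := H\<rparr>) (\<lambda>n. R n \<inter> H)"
proof -
  interpret H: group "G\<lparr>carrier := H\<rparr>"
    using subgroup.subgroup_is_group[OF assms group_axioms] .
  show ?thesis
    by unfold_locales
      (use assms R_finite R_inv R_cover in \<open>auto simp: subgroup.m_inv_closed subgroup.mem_carrier\<close>)
qed

text \<open>\<open>\<phi>\<close> is an isomorphism of the Cayley graphs of \<open>R n\<close> and
  \<open>T n\<close> for all \<open>n\<close> simultaneously. It may move the identity;
  normalisation is a separate hypothesis where it is used.\<close>

locale filtered_iso = A: filtered_group G R + B: filtered_group H T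
  for G :: "('a, 'm) monoid_scheme" and R and H :: "('b, 'n) monoid_scheme" and T +
  fixes \<phi> :: "'a \<Rightarrow> 'b"
  assumes bij: "bij_betw \<phi> (carrier G) (carrier H)"
    and adj: "u \<in> carrier G \<Longrightarrow> v \<in> carrier G \<Longrightarrow>
      inv\<^bsub>G\<^esub> u \<otimes>\<^bsub>G\<^esub> v \<in> R n \<longleftrightarrow> inv\<^bsub>H\<^esub> \<phi> u \<otimes>\<^bsub>H\<^esub> \<phi> v \<in> T n"
begin

lemma closed [simp]: "x \<in> carrier G \<Longrightarrow> \<phi> x \<in> carrier H"
  using bij by (auto simp: bij_betw_def)

abbreviation \<phi>' :: "'b \<Rightarrow> 'a" where "\<phi>' \<equiv> inv_into (carrier G) \<phi>"

lemma inverse_simps [simp]: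
  "y \<in> carrier H \<Longrightarrow> \<phi>' y \<in> carrier G"
  "y \<in> carrier H \<Longrightarrow> \<phi> (\<phi>' y) = y"
  "x \<in> carrier G \<Longrightarrow> \<phi>' (\<phi> x) = x"
  using bij bij_betw_inv_into_right[OF bij] bij_betw_inv_into_left[OF bij] bij_betwE[OF bij_betw_inv_into[OF bij]]
  by auto

lemma inverse_filtered_iso: "filtered_iso H T G R \<phi>'"
proof unfold_locales
  show "bij_betw \<phi>' (carrier H) (carrier G)"
    using bij_betw_inv_into[OF bij] .
  show "inv\<^bsub>H\<^esub> u \<otimes>\<^bsub>H\<^esub> v \<in> T n \<longleftrightarrow> inv\<^bsub>G\<^esub> \<phi>' u \<otimes>\<^bsub>G\<^esub> \<phi>' v \<in> R n"
    if "u \<in> carrier H" "v \<in> carrier H" for u v n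
    using adj[of "\<phi>' u" "\<phi>' v" n] that by simp
qed

lemma increment_mem:
  assumes "g \<in> carrier G" "x \<in> R n"
  shows "inv\<^bsub>H\<^esub> \<phi> g \<otimes>\<^bsub>H\<^esub> \<phi> (g \<otimes>\<^bsub>G\<^esub> x) \<in> T n"
proof -
  have "x \<in> carrier G"
    using assms A.R_subset by blast
  then show ?thesis
    using adj[of g "g \<otimes>\<^bsub>G\<^esub> x" n] assms by simp
qed

text \<open>The Lipschitz property in discrete form: for \<open>x\<close> in \<open>R n\<close>, all
  increments in the direction \<open>x\<close> lie in \<open>T n\<close>.\<close>

lemma finite_increments:
  assumes "x \<in> carrier G"
  obtains F where "finite F" "\<And>g. g \<in> carrier G \<Longrightarrow> inv\<^bsub>H\<^esub> \<phi> g \<otimes>\<^bsub>H\<^esub> \<phi> (g \<otimes>\<^bsub>G\<^esub> x) \<in> F"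
proof -
  obtain n where "x \<in> R n"
    using A.R_cover assms by blast
  then show ?thesis
    using that[of "T n"] increment_mem B.R_finite by blast
qed

text \<open>For fixed \<open>x\<close>, sending \<open>s\<close> to
  \<open>inv (\<phi> x) \<otimes> \<phi> (x \<otimes> s)\<close> is a bijection from
  \<open>R n\<close> onto \<open>T n\<close>, so the increments add up to the sum of
  \<open>\<chi>\<close> over \<open>T n\<close>, which is 0.\<close>

lemma harmonic_pullback:
  assumes \<chi>: "real_hom H \<chi>"
  shows "A.harmonic (\<lambda>x. \<chi> (\<phi> x))"
  unfolding A.harmonic_def
proof (intro allI ballI)
  fix n x assume x: "x \<in> carrier G"
  have R: "s \<in> carrier G" if "s \<in> R n" for s
    using A.R_subset that by blast
  have T: "t \<in> carrier H" if "t \<in> T n" for t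
    using B.R_subset that by blast
  have "(\<Sum>s\<in>R n. \<chi> (\<phi> (x \<otimes>\<^bsub>G\<^esub> s)) - \<chi> (\<phi> x)) =
      (\<Sum>s\<in>R n. \<chi> (inv\<^bsub>H\<^esub> \<phi> x \<otimes>\<^bsub>H\<^esub> \<phi> (x \<otimes>\<^bsub>G\<^esub> s)))"
    by (rule sum.cong) (auto simp: B.real_hom_simps[OF \<chi>] x R)
  also have "\<dots> = (\<Sum>t\<in>T n. \<chi> t)"
  proof (rule sum.reindex_bij_witness[where i = "\<lambda>t. inv\<^bsub>G\<^esub> x \<otimes>\<^bsub>G\<^esub> \<phi>' (\<phi> x \<otimes>\<^bsub>H\<^esub> t)"
        and j = "\<lambda>s. inv\<^bsub>H\<^esub> \<phi> x \<otimes>\<^bsub>H\<^esub> \<phi> (x \<otimes>\<^bsub>G\<^esub> s)"])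
    fix s assume s: "s \<in> R n"
    show "inv\<^bsub>G\<^esub> x \<otimes>\<^bsub>G\<^esub> \<phi>' (\<phi> x \<otimes>\<^bsub>H\<^esub> (inv\<^bsub>H\<^esub> \<phi> x \<otimes>\<^bsub>H\<^esub> \<phi> (x \<otimes>\<^bsub>G\<^esub> s))) = s"
      using s R x by simp
    show "inv\<^bsub>H\<^esub> \<phi> x \<otimes>\<^bsub>H\<^esub> \<phi> (x \<otimes>\<^bsub>G\<^esub> s) \<in> T n"
      using increment_mem x s .
  next
    fix t assume t: "t \<in> T n"
    show "inv\<^bsub>H\<^esub> \<phi> x \<otimes>\<^bsub>H\<^esub> \<phi> (x \<otimes>\<^bsub>G\<^esub> (inv\<^bsub>G\<^esub> x \<otimes>\<^bsub>G\<^esub> \<phi>' (\<phi> x \<otimes>\<^bsub>H\<^esub> t))) = t"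
      using t T x by simp
    show "inv\<^bsub>G\<^esub> x \<otimes>\<^bsub>G\<^esub> \<phi>' (\<phi> x \<otimes>\<^bsub>H\<^esub> t) \<in> R n"
      using adj[of x "\<phi>' (\<phi> x \<otimes>\<^bsub>H\<^esub> t)" n] t T x by simp
  qed simp
  also have "\<dots> = 0"
    by (rule B.real_hom_sum_zero[OF \<chi>])
  finally show "(\<Sum>s\<in>R n. \<chi> (\<phi> (x \<otimes>\<^bsub>G\<^esub> s)) - \<chi> (\<phi> x)) = 0" .
qed

text \<open>The pullback is harmonic, and Lipschitz by \<open>finite_increments\<close>, hence a
  homomorphism up to the constant \<open>\<chi> (\<phi> \<one>) = 0\<close>.\<close>

lemma real_hom_pullback:
  assumes nil: "upper_central_series G c = carrier G" and \<chi>: "real_hom H \<chi>"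
    and one: "\<phi> \<one>\<^bsub>G\<^esub> = \<one>\<^bsub>H\<^esub>"
  shows "real_hom G (\<lambda>x. \<chi> (\<phi> x))"
proof -
  have lip: "\<exists>L. \<forall>x \<in> carrier G. \<bar>\<chi> (\<phi> (x \<otimes>\<^bsub>G\<^esub> y)) - \<chi> (\<phi> x)\<bar> \<le> L" if y: "y \<in> carrier G" for y
  proof -
    obtain F where F: "finite F" "\<And>g. g \<in> carrier G \<Longrightarrow> inv\<^bsub>H\<^esub> \<phi> g \<otimes>\<^bsub>H\<^esub> \<phi> (g \<otimes>\<^bsub>G\<^esub> y) \<in> F"
      using finite_increments y by blast
    have "\<bar>\<chi> (\<phi> (x \<otimes>\<^bsub>G\<^esub> y)) - \<chi> (\<phi> x)\<bar> \<le> (\<Sum>t\<in>F. \<bar>\<chi> t\<bar>)" if "x \<in> carrier G" for x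
    proof -
      have "\<chi> (\<phi> (x \<otimes>\<^bsub>G\<^esub> y)) - \<chi> (\<phi> x) = \<chi> (inv\<^bsub>H\<^esub> \<phi> x \<otimes>\<^bsub>H\<^esub> \<phi> (x \<otimes>\<^bsub>G\<^esub> y))"
        using that y by (simp add: B.real_hom_simps[OF \<chi>])
      then show ?thesis
        using member_le_sum[OF F(2)[OF that], of "\<lambda>t. \<bar>\<chi> t\<bar>"] F(1) by simp
    qed
    then show ?thesis by blast
  qed
  have "\<chi> (\<phi> (x \<otimes>\<^bsub>G\<^esub> y)) = \<chi> (\<phi> x) + \<chi> (\<phi> y)" if "x \<in> carrier G" "y \<in> carrier G" for x y
    using A.lipschitz_harmonic_affine[OF nil harmonic_pullback[OF \<chi>] lip that]
    by (simp add: one B.real_hom_simps[OF \<chi>])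
  then show ?thesis
    by (simp add: real_hom_def)
qed

lemma real_kernel_coset:
  assumes nil: "upper_central_series G c = carrier G" and one: "\<phi> \<one>\<^bsub>G\<^esub> = \<one>\<^bsub>H\<^esub>"
    and uv: "u \<in> carrier G" "v \<in> carrier G" and k: "inv\<^bsub>G\<^esub> u \<otimes>\<^bsub>G\<^esub> v \<in> real_kernel G"
  shows "inv\<^bsub>H\<^esub> \<phi> u \<otimes>\<^bsub>H\<^esub> \<phi> v \<in> real_kernel H"
  unfolding real_kernel_def
proof (intro CollectI conjI allI impI)
  fix \<chi> assume \<chi>: "real_hom H \<chi>"
  have \<chi>': "real_hom G (\<lambda>x. \<chi> (\<phi> x))"
    using real_hom_pullback[OF nil \<chi> one] .
  then have "\<chi> (\<phi> (inv\<^bsub>G\<^esub> u \<otimes>\<^bsub>G\<^esub> v)) = 0"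
    using k unfolding real_kernel_def by blast
  then have "\<chi> (\<phi> u) = \<chi> (\<phi> v)"
    using A.real_hom_simps(2,3)[OF \<chi>'] uv by simp
  then show "\<chi> (inv\<^bsub>H\<^esub> \<phi> u \<otimes>\<^bsub>H\<^esub> \<phi> v) = 0"
    using uv by (simp add: B.real_hom_simps[OF \<chi>])
qed (use uv in simp)

text \<open>Every \<open>\<chi>\<close> turns \<open>\<phi>\<close> into a homomorphism, so it kills
  the defect of multiplicativity. What remains is to show that this defect is trivial.\<close>

lemma hom_mod_real_kernel:
  assumes nil: "upper_central_series G c = carrier G" and one: "\<phi> \<one>\<^bsub>G\<^esub> = \<one>\<^bsub>H\<^esub>"
    and "g \<in> carrier G" "h \<in> carrier G"
  shows "inv\<^bsub>H\<^esub> \<phi> h \<otimes>\<^bsub>H\<^esub> (inv\<^bsub>H\<^esub> \<phi> g \<otimes>\<^bsub>H\<^esub> \<phi> (g \<otimes>\<^bsub>G\<^esub> h)) \<in> real_kernel H"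
  unfolding real_kernel_def
proof (intro CollectI conjI allI impI)
  fix \<chi> assume \<chi>: "real_hom H \<chi>"
  have "\<chi> (\<phi> (g \<otimes>\<^bsub>G\<^esub> h)) = \<chi> (\<phi> g) + \<chi> (\<phi> h)"
    using A.real_hom_simps(3)[OF real_hom_pullback[OF nil \<chi> one]] assms by blast
  then show "\<chi> (inv\<^bsub>H\<^esub> \<phi> h \<otimes>\<^bsub>H\<^esub> (inv\<^bsub>H\<^esub> \<phi> g \<otimes>\<^bsub>H\<^esub> \<phi> (g \<otimes>\<^bsub>G\<^esub> h))) = 0"
    using assms by (simp add: B.real_hom_simps[OF \<chi>])
qed (use assms in simp)

text \<open>Moves the base point: the translate fixes the identity, so results on normalised
  isomorphisms become available at every \<open>g\<close>.\<close>

lemma translate_filtered_iso: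
  assumes g: "g \<in> carrier G"
  shows "filtered_iso G R H T (\<lambda>x. inv\<^bsub>H\<^esub> \<phi> g \<otimes>\<^bsub>H\<^esub> \<phi> (g \<otimes>\<^bsub>G\<^esub> x))"
proof unfold_locales
  show "bij_betw (\<lambda>x. inv\<^bsub>H\<^esub> \<phi> g \<otimes>\<^bsub>H\<^esub> \<phi> (g \<otimes>\<^bsub>G\<^esub> x)) (carrier G) (carrier H)"
    by (rule bij_betw_byWitness[where f' = "\<lambda>y. inv\<^bsub>G\<^esub> g \<otimes>\<^bsub>G\<^esub> \<phi>' (\<phi> g \<otimes>\<^bsub>H\<^esub> y)"]) (use g in auto)
  fix u v n assume uv: "u \<in> carrier G" "v \<in> carrier G"
  have "inv\<^bsub>G\<^esub> u \<otimes>\<^bsub>G\<^esub> v = inv\<^bsub>G\<^esub> (g \<otimes>\<^bsub>G\<^esub> u) \<otimes>\<^bsub>G\<^esub> (g \<otimes>\<^bsub>G\<^esub> v)"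
    using g uv by (simp add: A.inv_mult_group A.m_assoc)
  moreover have "inv\<^bsub>H\<^esub> (inv\<^bsub>H\<^esub> \<phi> g \<otimes>\<^bsub>H\<^esub> \<phi> (g \<otimes>\<^bsub>G\<^esub> u)) \<otimes>\<^bsub>H\<^esub> (inv\<^bsub>H\<^esub> \<phi> g \<otimes>\<^bsub>H\<^esub> \<phi> (g \<otimes>\<^bsub>G\<^esub> v)) =
      inv\<^bsub>H\<^esub> \<phi> (g \<otimes>\<^bsub>G\<^esub> u) \<otimes>\<^bsub>H\<^esub> \<phi> (g \<otimes>\<^bsub>G\<^esub> v)"
    using g uv by (simp add: B.inv_mult_group B.m_assoc)
  ultimately show "inv\<^bsub>G\<^esub> u \<otimes>\<^bsub>G\<^esub> v \<in> R n \<longleftrightarrow>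
      inv\<^bsub>H\<^esub> (inv\<^bsub>H\<^esub> \<phi> g \<otimes>\<^bsub>H\<^esub> \<phi> (g \<otimes>\<^bsub>G\<^esub> u)) \<otimes>\<^bsub>H\<^esub> (inv\<^bsub>H\<^esub> \<phi> g \<otimes>\<^bsub>H\<^esub> \<phi> (g \<otimes>\<^bsub>G\<^esub> v)) \<in> T n"
    using adj[of "g \<otimes>\<^bsub>G\<^esub> u" "g \<otimes>\<^bsub>G\<^esub> v"] g uv by simp
qed

end

section \<open>Equivariance under the real kernel, and multiplicativity\<close>

context filtered_iso
begin

lemma hom_if_abelian:
  assumes "upper_central_series G c = carrier G" "\<phi> \<one>\<^bsub>G\<^esub> = \<one>\<^bsub>H\<^esub>"
    and "torsion_free H" "upper_central_series H 1 = carrier H"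
  shows "\<phi> \<in> hom G H"
proof (rule homI)
  fix g h assume gh: "g \<in> carrier G" "h \<in> carrier G"
  have "inv\<^bsub>H\<^esub> \<phi> h \<otimes>\<^bsub>H\<^esub> (inv\<^bsub>H\<^esub> \<phi> g \<otimes>\<^bsub>H\<^esub> \<phi> (g \<otimes>\<^bsub>G\<^esub> h)) = \<one>\<^bsub>H\<^esub>"
    using hom_mod_real_kernel[OF assms(1,2) gh] B.real_kernel_abelian[OF assms(3,4)] by simp
  then have "\<phi> g \<otimes>\<^bsub>H\<^esub> (\<phi> h \<otimes>\<^bsub>H\<^esub> (inv\<^bsub>H\<^esub> \<phi> h \<otimes>\<^bsub>H\<^esub> (inv\<^bsub>H\<^esub> \<phi> g \<otimes>\<^bsub>H\<^esub> \<phi> (g \<otimes>\<^bsub>G\<^esub> h)))) = \<phi> g \<otimes>\<^bsub>H\<^esub> \<phi> h"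
    using gh by simp
  then show "\<phi> (g \<otimes>\<^bsub>G\<^esub> h) = \<phi> g \<otimes>\<^bsub>H\<^esub> \<phi> h"
    using gh by simp
qed simp

text \<open>On \<open>N\<close> both \<open>\<phi>\<close> and \<open>?b\<close> are homomorphisms,
  the latter because it is the translate \<open>?\<psi>\<close> preceded and followed by
  conjugations. Their difference is an increment of \<open>\<phi>\<close> in the direction
  \<open>g\<close> times a constant, so it takes finitely many values and the two agree. The
  hypothesis \<open>hom\<close> speaks of all normalised isomorphisms because it is applied to
  \<open>?\<psi>\<close> as well.\<close>

lemma equivariant:
  assumes tf: "torsion_free H" "upper_central_series H c = carrier H" and one: "\<phi> \<one>\<^bsub>G\<^esub> = \<one>\<^bsub>H\<^esub>"
    and N: "N \<lhd> G"
    and hom: "\<And>\<psi> m n. filtered_iso G R H T \<psi> \<Longrightarrow> \<psi> \<one>\<^bsub>G\<^esub> = \<one>\<^bsub>H\<^esub> \<Longrightarrow> m \<in> N \<Longrightarrow> n \<in> N \<Longrightarrow>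
      \<psi> (m \<otimes>\<^bsub>G\<^esub> n) = \<psi> m \<otimes>\<^bsub>H\<^esub> \<psi> n"
    and m: "m \<in> N" and g: "g \<in> carrier G"
  shows "\<phi> (m \<otimes>\<^bsub>G\<^esub> g) = \<phi> m \<otimes>\<^bsub>H\<^esub> \<phi> g"
proof -
  interpret N: normal N G by fact
  let ?K = "G\<lparr>carrier := N\<rparr>"
  let ?b = "\<lambda>m. \<phi> (m \<otimes>\<^bsub>G\<^esub> g) \<otimes>\<^bsub>H\<^esub> inv\<^bsub>H\<^esub> \<phi> g"
  let ?\<psi> = "\<lambda>x. inv\<^bsub>H\<^esub> \<phi> g \<otimes>\<^bsub>H\<^esub> \<phi> (g \<otimes>\<^bsub>G\<^esub> x)"
  let ?c = "\<lambda>m. inv\<^bsub>G\<^esub> g \<otimes>\<^bsub>G\<^esub> m \<otimes>\<^bsub>G\<^esub> g"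
  have NG: "x \<in> carrier G" if "x \<in> N" for x
    using N.subset that by blast
  have K: "group ?K"
    using N.subgroup_is_group[OF A.group_axioms] .
  have iso: "filtered_iso G R H T ?\<psi>"
    using translate_filtered_iso[OF g] .
  have one': "?\<psi> \<one>\<^bsub>G\<^esub> = \<one>\<^bsub>H\<^esub>"
    using g by simp
  have b: "?b m = \<phi> g \<otimes>\<^bsub>H\<^esub> ?\<psi> (?c m) \<otimes>\<^bsub>H\<^esub> inv\<^bsub>H\<^esub> \<phi> g" if "m \<in> N" for m
    using that NG g by (simp add: A.m_assoc)
  have "\<phi> \<in> hom ?K H"
    by (rule homI) (use hom[OF filtered_iso_axioms one] NG in auto)
  moreover have "?b \<in> hom ?K H"
  proof (rule homI)
    fix x y assume "x \<in> carrier ?K" "y \<in> carrier ?K"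
    then have xy: "x \<in> N" "y \<in> N" by auto
    have cN: "?c x \<in> N" "?c y \<in> N"
      using xy N.inv_op_closed1 g by auto
    have "?c (x \<otimes>\<^bsub>G\<^esub> y) = ?c x \<otimes>\<^bsub>G\<^esub> ?c y"
      using xy NG g by (simp add: A.m_assoc)
    then have "?\<psi> (?c (x \<otimes>\<^bsub>G\<^esub> y)) = ?\<psi> (?c x) \<otimes>\<^bsub>H\<^esub> ?\<psi> (?c y)"
      using hom[OF iso one' cN] by simp
    moreover have "?\<psi> (?c z) \<in> carrier H" if "z \<in> N" for z
      using that NG g by simp
    ultimately have "\<phi> g \<otimes>\<^bsub>H\<^esub> ?\<psi> (?c (x \<otimes>\<^bsub>G\<^esub> y)) \<otimes>\<^bsub>H\<^esub> inv\<^bsub>H\<^esub> \<phi> g =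
       (\<phi> g \<otimes>\<^bsub>H\<^esub> ?\<psi> (?c x) \<otimes>\<^bsub>H\<^esub> inv\<^bsub>H\<^esub> \<phi> g) \<otimes>\<^bsub>H\<^esub> (\<phi> g \<otimes>\<^bsub>H\<^esub> ?\<psi> (?c y) \<otimes>\<^bsub>H\<^esub> inv\<^bsub>H\<^esub> \<phi> g)"
      using xy g NG by (simp add: B.m_assoc)
    then show "?b (x \<otimes>\<^bsub>?K\<^esub> y) = ?b x \<otimes>\<^bsub>H\<^esub> ?b y"
      using b[OF xy(1)] b[OF xy(2)] b[OF N.m_closed[OF xy]] by simp
  qed (use NG g in auto)
  moreover obtain F where F: "finite F" "\<And>x. x \<in> carrier G \<Longrightarrow> inv\<^bsub>H\<^esub> \<phi> x \<otimes>\<^bsub>H\<^esub> \<phi> (x \<otimes>\<^bsub>G\<^esub> g) \<in> F"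
    using finite_increments g by blast
  moreover have "inv\<^bsub>H\<^esub> \<phi> x \<otimes>\<^bsub>H\<^esub> ?b x \<in> (\<lambda>y. y \<otimes>\<^bsub>H\<^esub> inv\<^bsub>H\<^esub> \<phi> g) ` F" if "x \<in> carrier ?K" for x
  proof -
    have "inv\<^bsub>H\<^esub> \<phi> x \<otimes>\<^bsub>H\<^esub> ?b x = (inv\<^bsub>H\<^esub> \<phi> x \<otimes>\<^bsub>H\<^esub> \<phi> (x \<otimes>\<^bsub>G\<^esub> g)) \<otimes>\<^bsub>H\<^esub> inv\<^bsub>H\<^esub> \<phi> g"
      using that NG g by (simp add: B.m_assoc)
    then show ?thesis
      using F(2) NG that by simp
  qed
  ultimately have "\<phi> m = ?b m"
    using B.homs_eq_if_finite_difference[OF tf K, of \<phi> ?b "(\<lambda>y. y \<otimes>\<^bsub>H\<^esub> inv\<^bsub>H\<^esub> \<phi> g) ` F" m] m by simp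
  then have "\<phi> m \<otimes>\<^bsub>H\<^esub> \<phi> g = ?b m \<otimes>\<^bsub>H\<^esub> \<phi> g"
    by simp
  also have "\<dots> = \<phi> (m \<otimes>\<^bsub>G\<^esub> g)"
    using m NG g by (simp add: B.m_assoc)
  finally show ?thesis by simp
qed

lemma conj_decompose:
  assumes "x \<in> carrier G" "z \<in> carrier G"
  shows "x \<otimes>\<^bsub>G\<^esub> z = commutator G x z \<otimes>\<^bsub>G\<^esub> (z \<otimes>\<^bsub>G\<^esub> x)"
  using A.commutator_mult[OF assms] by simp

text \<open>An equivariant \<open>\<phi>\<close> maps \<open>N \<inter> \<zeta>\<^sub>j\<close> into \<open>\<zeta>\<^sub>j\<close>: modulo \<open>\<zeta>\<^sub>j\<close>, the conjugates of \<open>\<phi> z\<close> for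
  \<open>z \<in> N \<inter> \<zeta>\<^bsub>j+1\<^esub>\<close> are increments of \<open>\<phi>\<close> in direction \<open>z\<close>, so there are finitely many.\<close>

lemma equivariant_upper_central_series:
  assumes tf: "torsion_free H" "upper_central_series H c = carrier H" and one: "\<phi> \<one>\<^bsub>G\<^esub> = \<one>\<^bsub>H\<^esub>"
    and N: "N \<lhd> G"
    and equi: "\<And>m g. m \<in> N \<Longrightarrow> g \<in> carrier G \<Longrightarrow> \<phi> (m \<otimes>\<^bsub>G\<^esub> g) = \<phi> m \<otimes>\<^bsub>H\<^esub> \<phi> g"
  shows "z \<in> N \<Longrightarrow> z \<in> upper_central_series G j \<Longrightarrow> \<phi> z \<in> upper_central_series H j"
proof (induction j arbitrary: z)
  case 0
  then show ?case
    using one by simp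
next
  case (Suc j)
  have z: "z \<in> carrier G"
    using Suc.prems(2) by simp
  obtain F where F: "finite F" "\<And>x. x \<in> carrier G \<Longrightarrow> inv\<^bsub>H\<^esub> \<phi> x \<otimes>\<^bsub>H\<^esub> \<phi> (x \<otimes>\<^bsub>G\<^esub> z) \<in> F"
    using finite_increments z by blast
  have "commutator H (\<phi> z) y \<in> upper_central_series H j" if y: "y \<in> carrier H" for y
  proof (rule B.commutator_mem_if_finite_conjugates[OF tf _ y F(1)])
    show "\<phi> z \<in> carrier H"
      using z by simp
    fix k :: nat
    let ?h = "\<phi>' (y [^]\<^bsub>H\<^esub> k)"
    have h: "?h \<in> carrier G" "\<phi> ?h = y [^]\<^bsub>H\<^esub> k"
      using y by simp_all
    let ?l = "commutator G ?h z"
    have l: "?l \<in> N" "?l \<in> upper_central_series G j"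
      using A.commutator_in_normal[OF N Suc.prems(1) h(1)]
        A.commutator_in_upper_central_series(2)[OF Suc.prems(2) h(1)] by auto
    then have lc: "?l \<in> carrier G" "\<phi> ?l \<in> upper_central_series H j"
      using h z Suc.IH by auto
    \<comment> \<open>Both \<open>?l\<close> and \<open>z\<close> lie in \<open>N\<close>, so
      equivariance turns the increment of \<open>\<phi>\<close> at \<open>?h\<close> into the
      conjugate of \<open>\<phi> ?l \<otimes> \<phi> z\<close> by \<open>y [^] k\<close>.\<close>
    have "\<phi> (?h \<otimes>\<^bsub>G\<^esub> z) = \<phi> ?l \<otimes>\<^bsub>H\<^esub> (\<phi> z \<otimes>\<^bsub>H\<^esub> \<phi> ?h)"
      unfolding conj_decompose[OF h(1) z] using equi l(1) Suc.prems(1) z h by simp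
    then have "inv\<^bsub>H\<^esub> (y [^]\<^bsub>H\<^esub> k) \<otimes>\<^bsub>H\<^esub> (\<phi> ?l \<otimes>\<^bsub>H\<^esub> \<phi> z) \<otimes>\<^bsub>H\<^esub> y [^]\<^bsub>H\<^esub> k \<in> F"
      using F(2)[OF h(1)] h(2) lc(1) z y by (simp add: B.m_assoc)
    then show "\<exists>l\<in>upper_central_series H j. inv\<^bsub>H\<^esub> (y [^]\<^bsub>H\<^esub> k) \<otimes>\<^bsub>H\<^esub> (l \<otimes>\<^bsub>H\<^esub> \<phi> z) \<otimes>\<^bsub>H\<^esub> y [^]\<^bsub>H\<^esub> k \<in> F"
      using lc(2) by blast
  qed
  then show ?case
    using z by simp
qed

text \<open>The defect of multiplicativity is pushed down the upper central series of
  \<open>H\<close> by following the finite orbits of \<open>\<psi>\<close>. Besides the equivariance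
  of \<open>\<phi>\<close>, each step uses that of its inverse under
  \<open>real_kernel H\<close>.\<close>

lemma hom_if_equivariant:
  assumes tfG: "torsion_free G" and nilG: "upper_central_series G c = carrier G"
    and tfH: "torsion_free H" and nilH: "upper_central_series H c = carrier H"
    and one: "\<phi> \<one>\<^bsub>G\<^esub> = \<one>\<^bsub>H\<^esub>"
    and equi: "\<And>m g. m \<in> real_kernel G \<Longrightarrow> g \<in> carrier G \<Longrightarrow> \<phi> (m \<otimes>\<^bsub>G\<^esub> g) = \<phi> m \<otimes>\<^bsub>H\<^esub> \<phi> g"
  shows "\<phi> \<in> hom G H"
proof -
  let ?N = "real_kernel G" and ?M = "real_kernel H"
  interpret I: filtered_iso H T G R \<phi>'
    by (rule inverse_filtered_iso)
  interpret N: normal ?N G by (rule A.real_kernel_normal)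
  interpret M: normal ?M H by (rule B.real_kernel_normal)
  have one': "\<phi>' \<one>\<^bsub>H\<^esub> = \<one>\<^bsub>G\<^esub>"
    using one by (metis A.one_closed inverse_simps(3))
  have MN: "\<phi>' m \<in> ?N" if "m \<in> ?M" for m
  proof -
    have "m \<in> carrier H"
      using that M.subset by blast
    then show ?thesis
      using I.real_kernel_coset[OF nilH one', of "\<one>\<^bsub>H\<^esub>" m] that by (simp add: one')
  qed
  have equi': "\<phi>' (m \<otimes>\<^bsub>H\<^esub> y) = \<phi>' m \<otimes>\<^bsub>G\<^esub> \<phi>' y" if "m \<in> ?M" "y \<in> carrier H" for m y
  proof -
    have m: "m \<in> carrier H"
      using that M.subset by blast
    have "\<phi> (\<phi>' m \<otimes>\<^bsub>G\<^esub> \<phi>' y) = m \<otimes>\<^bsub>H\<^esub> y"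
      using equi[OF MN[OF that(1)]] that m by simp
    then have "\<phi>' (m \<otimes>\<^bsub>H\<^esub> y) = \<phi>' (\<phi> (\<phi>' m \<otimes>\<^bsub>G\<^esub> \<phi>' y))"
      by simp
    then show ?thesis
      using that m by simp
  qed
  \<comment> \<open>\<open>d\<close> counts the terms descended, starting from term
    \<open>c\<close>, which is all of \<open>H\<close>.\<close>
  have "d \<le> c \<Longrightarrow> \<forall>g \<in> carrier G. \<forall>h \<in> carrier G.
      inv\<^bsub>H\<^esub> \<phi> h \<otimes>\<^bsub>H\<^esub> (inv\<^bsub>H\<^esub> \<phi> g \<otimes>\<^bsub>H\<^esub> \<phi> (g \<otimes>\<^bsub>G\<^esub> h)) \<in> upper_central_series H (c - d)" for d
  proof (induction d)
    case 0
    then show ?case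
      by (simp add: nilH)
  next
    case (Suc d)
    define j where "j = c - Suc d"
    have Sj: "c - d = Suc j"
      using Suc.prems by (simp add: j_def)
    note U = B.upper_central_series_normal[of "Suc j"] B.upper_central_series_subgroup[of "Suc j"]
    obtain Q :: "'b set monoid" and p where p: "group_hom H Q p"
      "\<And>x. x \<in> carrier H \<Longrightarrow> p x = \<one>\<^bsub>Q\<^esub> \<longleftrightarrow> x \<in> upper_central_series H j"
      using B.upper_central_series_quotient by blast
    interpret p: group_hom H Q p by (rule p)
    \<comment> \<open>\<open>V\<close> records what is known of the defect: it lies in the real
      kernel and, by induction, in term \<open>j + 1\<close>. Modulo term \<open>j\<close>, elements
      of \<open>V\<close> commute with everything.\<close>
    define V where "V = ?M \<inter> upper_central_series H (Suc j)"
    have V_closed: "a \<in> carrier H" if "a \<in> V" for a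
      using that M.subset unfolding V_def by blast
    have V_mult: "a \<otimes>\<^bsub>H\<^esub> b \<in> V" if "a \<in> V" "b \<in> V" for a b
      using that M.m_closed subgroup.m_closed[OF U(2)] unfolding V_def by blast
    have V_conj: "y \<otimes>\<^bsub>H\<^esub> a \<otimes>\<^bsub>H\<^esub> inv\<^bsub>H\<^esub> y \<in> V" if "a \<in> V" "y \<in> carrier H" for a y
      using that M.inv_op_closed2 normal.inv_op_closed2[OF U(1)] unfolding V_def by blast
    have V_central: "p a \<otimes>\<^bsub>Q\<^esub> p y = p y \<otimes>\<^bsub>Q\<^esub> p a" if "a \<in> V" "y \<in> carrier H" for a y
    proof -
      have "commutator H a y \<in> upper_central_series H j"
        using that B.commutator_in_upper_central_series(1) unfolding V_def by blast
      then have "p (commutator H a y) = \<one>\<^bsub>Q\<^esub>"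
        using p(2) that V_closed by simp
      then show ?thesis
        using that V_closed by (simp add: p.hom_commutator p.H.commutator_eq_one_iff)
    qed
    show ?case
      unfolding j_def[symmetric]
    proof (intro ballI)
      fix g h assume g: "g \<in> carrier G" and h: "h \<in> carrier G"
      define \<psi> where "\<psi> y = inv\<^bsub>H\<^esub> \<phi> g \<otimes>\<^bsub>H\<^esub> \<phi> (g \<otimes>\<^bsub>G\<^esub> \<phi>' y)" for y
      have \<psi>_closed: "\<psi> y \<in> carrier H" if "y \<in> carrier H" for y
        using that g by (simp add: \<psi>_def)
      have \<psi>_V: "inv\<^bsub>H\<^esub> y \<otimes>\<^bsub>H\<^esub> \<psi> y \<in> V" if "y \<in> carrier H" for y
      proof -
        have "inv\<^bsub>H\<^esub> y \<otimes>\<^bsub>H\<^esub> \<psi> y \<in> upper_central_series H (Suc j)"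
          using Suc.IH[OF Suc_leD[OF Suc.prems], unfolded Sj, rule_format, OF g inverse_simps(1)[OF that]] that
          by (simp add: \<psi>_def del: upper_central_series.simps)
        moreover have "inv\<^bsub>H\<^esub> y \<otimes>\<^bsub>H\<^esub> \<psi> y \<in> ?M"
          using hom_mod_real_kernel[OF nilG one g inverse_simps(1)[OF that]] that by (simp add: \<psi>_def)
        ultimately show ?thesis
          unfolding V_def by blast
      qed
      \<comment> \<open>Modulo term \<open>j\<close>, \<open>\<psi>\<close> commutes with right
        multiplication by \<open>V\<close>. To use equivariance, \<open>a\<close> is moved to the
        left of \<open>y\<close> as its conjugate \<open>?m\<close>; then \<open>?n\<close> is moved
        in front of \<open>g\<close>, at the cost of a commutator \<open>?k\<close> whose image is
        trivial in \<open>Q\<close>.\<close>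
      have \<psi>_mult: "p (\<psi> (y \<otimes>\<^bsub>H\<^esub> a)) = p (\<psi> y) \<otimes>\<^bsub>Q\<^esub> p a" if y: "y \<in> carrier H" and a: "a \<in> V" for y a
      proof -
        let ?m = "y \<otimes>\<^bsub>H\<^esub> a \<otimes>\<^bsub>H\<^esub> inv\<^bsub>H\<^esub> y"
        let ?n = "\<phi>' ?m" and ?h = "\<phi>' y"
        let ?k = "commutator G g ?n"
        have m: "?m \<in> V" "?m \<in> carrier H"
          using V_conj[OF a y] V_closed by blast+
        have mV: "?m \<in> ?M" "?m \<in> upper_central_series H (Suc j)"
          using m(1) unfolding V_def by blast+
        have n: "?n \<in> ?N" "?n \<in> upper_central_series G (Suc j)" "?n \<in> carrier G"
          using mV(1) m(2) MN
            I.equivariant_upper_central_series[OF tfG nilG one' B.real_kernel_normal equi' mV] by simp_all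
        have k: "?k \<in> ?N" "?k \<in> upper_central_series G j" "?k \<in> carrier G"
          using A.commutator_in_normal[OF A.real_kernel_normal n(1) g]
            A.commutator_in_upper_central_series(2)[OF n(2) g] n(3) g by simp_all
        then have "\<phi> ?k \<in> upper_central_series H j"
          using equivariant_upper_central_series[OF tfH nilH one A.real_kernel_normal equi] by blast
        then have pk: "p (\<phi> ?k) = \<one>\<^bsub>Q\<^esub>"
          using p(2) k by simp
        have "y \<otimes>\<^bsub>H\<^esub> a = ?m \<otimes>\<^bsub>H\<^esub> y"
          using y V_closed[OF a] by (simp add: B.m_assoc)
        then have "\<phi>' (y \<otimes>\<^bsub>H\<^esub> a) = ?n \<otimes>\<^bsub>G\<^esub> ?h"
          using equi'[OF mV(1) y] by simp
        then have "g \<otimes>\<^bsub>G\<^esub> \<phi>' (y \<otimes>\<^bsub>H\<^esub> a) = ?k \<otimes>\<^bsub>G\<^esub> (?n \<otimes>\<^bsub>G\<^esub> (g \<otimes>\<^bsub>G\<^esub> ?h))"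
          using conj_decompose[OF g n(3)] g n(3) k(3) y by (simp flip: A.m_assoc)
        then have "\<psi> (y \<otimes>\<^bsub>H\<^esub> a) = inv\<^bsub>H\<^esub> \<phi> g \<otimes>\<^bsub>H\<^esub> (\<phi> ?k \<otimes>\<^bsub>H\<^esub> (?m \<otimes>\<^bsub>H\<^esub> \<phi> (g \<otimes>\<^bsub>G\<^esub> ?h)))"
          unfolding \<psi>_def using equi[OF k(1)] equi[OF n(1)] g n(3) y m(2) by simp
        then have "p (\<psi> (y \<otimes>\<^bsub>H\<^esub> a)) = p (inv\<^bsub>H\<^esub> \<phi> g) \<otimes>\<^bsub>Q\<^esub> (p ?m \<otimes>\<^bsub>Q\<^esub> p (\<phi> (g \<otimes>\<^bsub>G\<^esub> ?h)))"
          using pk g y k(3) m(2) V_closed[OF a] by (simp add: p.H.m_assoc)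
        also have "p ?m \<otimes>\<^bsub>Q\<^esub> p (\<phi> (g \<otimes>\<^bsub>G\<^esub> ?h)) = p (\<phi> (g \<otimes>\<^bsub>G\<^esub> ?h)) \<otimes>\<^bsub>Q\<^esub> p ?m"
          using V_central[OF m(1)] g y by simp
        also have "p ?m = p a"
        proof -
          have "p ?m = p y \<otimes>\<^bsub>Q\<^esub> p a \<otimes>\<^bsub>Q\<^esub> inv\<^bsub>Q\<^esub> p y"
            using y V_closed[OF a] by simp
          also have "p y \<otimes>\<^bsub>Q\<^esub> p a = p a \<otimes>\<^bsub>Q\<^esub> p y"
            using V_central[OF a y] by simp
          finally show ?thesis
            using y V_closed[OF a] by (simp add: p.H.m_assoc)
        qed
        finally show ?thesis
          unfolding \<psi>_def using g y V_closed[OF a] by (simp add: p.H.m_assoc)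
      qed
      define y where "y = \<phi> h"
      have y: "y \<in> carrier H" "\<phi>' y = h"
        using h by (simp_all add: y_def)
      define t where "t = inv\<^bsub>H\<^esub> y \<otimes>\<^bsub>H\<^esub> \<psi> y"
      have t: "t \<in> V" "t \<in> carrier H"
        using \<psi>_V[OF y(1)] V_closed unfolding t_def by blast+
      \<comment> \<open>By \<open>\<psi>_mult\<close>, each application of \<open>\<psi>\<close>
        contributes one more factor \<open>t\<close> modulo term \<open>j\<close>.\<close>
      have iter: "\<exists>a \<in> V. (\<psi> ^^ i) y = y \<otimes>\<^bsub>H\<^esub> a \<and> p a = p t [^]\<^bsub>Q\<^esub> i" for i :: nat
      proof (induction i)
        case 0
        have "\<one>\<^bsub>H\<^esub> \<in> V"
          unfolding V_def using M.one_closed subgroup.one_closed[OF U(2)] by blast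
        then show ?case
          using y by (intro bexI[of _ "\<one>\<^bsub>H\<^esub>"]) auto
      next
        case (Suc i)
        then obtain a where a: "a \<in> V" "(\<psi> ^^ i) y = y \<otimes>\<^bsub>H\<^esub> a" "p a = p t [^]\<^bsub>Q\<^esub> i"
          by blast
        let ?b = "inv\<^bsub>H\<^esub> (y \<otimes>\<^bsub>H\<^esub> a) \<otimes>\<^bsub>H\<^esub> \<psi> (y \<otimes>\<^bsub>H\<^esub> a)"
        have ac: "a \<in> carrier H"
          using a(1) V_closed by blast
        have b: "?b \<in> V"
          using \<psi>_V y(1) ac by simp
        have "\<psi> (y \<otimes>\<^bsub>H\<^esub> a) = y \<otimes>\<^bsub>H\<^esub> (a \<otimes>\<^bsub>H\<^esub> ?b)"
          using y(1) ac \<psi>_closed[of "y \<otimes>\<^bsub>H\<^esub> a"] by (simp add: B.m_assoc B.inv_mult_group)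
        then have 1: "(\<psi> ^^ Suc i) y = y \<otimes>\<^bsub>H\<^esub> (a \<otimes>\<^bsub>H\<^esub> ?b)"
          using a(2) by simp
        have "a \<otimes>\<^bsub>H\<^esub> ?b = inv\<^bsub>H\<^esub> y \<otimes>\<^bsub>H\<^esub> \<psi> (y \<otimes>\<^bsub>H\<^esub> a)"
          using y(1) ac \<psi>_closed[of "y \<otimes>\<^bsub>H\<^esub> a"] by (simp add: B.m_assoc B.inv_mult_group)
        then have "p (a \<otimes>\<^bsub>H\<^esub> ?b) = p t \<otimes>\<^bsub>Q\<^esub> p a"
          using \<psi>_mult[OF y(1) a(1)] y(1) ac \<psi>_closed by (simp add: t_def p.H.m_assoc)
        also have "\<dots> = p t [^]\<^bsub>Q\<^esub> Suc i"
          unfolding a(3) using t(2) p.H.nat_pow_Suc2[of "p t" i] by simp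
        finally show ?case
          using 1 V_mult[OF a(1) b] by blast
      qed
      obtain n where n: "y \<in> T n"
        using B.R_cover y(1) by blast
      \<comment> \<open>The same \<open>n\<close> serves throughout: as \<open>\<phi>\<close> fixes
        the identity, its inverse maps \<open>T n\<close> into \<open>R n\<close>, and the increment
        of \<open>\<phi>\<close> at \<open>g\<close> in a direction from \<open>R n\<close> lies in
        \<open>T n\<close> again.\<close>
      have orbit: "(\<psi> ^^ i) y \<in> T n" for i :: nat
      proof (induction i)
        case (Suc i)
        let ?x = "(\<psi> ^^ i) y"
        have x: "?x \<in> carrier H"
          using Suc B.R_subset by blast
        have "\<phi>' ?x \<in> R n"
          using adj[of "\<one>\<^bsub>G\<^esub>" "\<phi>' ?x" n] x Suc by (simp add: one)
        then have "\<psi> ?x \<in> T n"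
          using increment_mem[OF g] \<psi>_def[of ?x] by simp
        then show ?case by simp
      qed (simp add: n)
      \<comment> \<open>A repetition in the orbit equates two powers of \<open>p t\<close>, so a
        positive power of \<open>t\<close> lies in term \<open>j\<close>, and \<open>t\<close>
        itself does by isolation.\<close>
      obtain i k :: nat where ik: "i < k" "(\<psi> ^^ i) y = (\<psi> ^^ k) y"
        by (rule pigeonhole_sequence[of "T n" "\<lambda>i. (\<psi> ^^ i) y", OF B.R_finite orbit])
      obtain a b where "a \<in> V" "b \<in> V" "y \<otimes>\<^bsub>H\<^esub> a = y \<otimes>\<^bsub>H\<^esub> b"
        "p a = p t [^]\<^bsub>Q\<^esub> i" "p b = p t [^]\<^bsub>Q\<^esub> k"
        using iter[of i] iter[of k] ik(2) by metis
      then have "p t [^]\<^bsub>Q\<^esub> i = p t [^]\<^bsub>Q\<^esub> k"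
        using y(1) V_closed by simp
      then have "p t [^]\<^bsub>Q\<^esub> (k - i) = \<one>\<^bsub>Q\<^esub>"
        using p.H.pow_eq_pow_imp_one[OF _ ik(1)] t(2) by simp
      then have "t [^]\<^bsub>H\<^esub> (k - i) \<in> upper_central_series H j"
        using p(2) t(2) by (simp flip: p.hom_nat_pow)
      then have "t \<in> upper_central_series H j"
        using B.upper_central_series_isolated[OF tfH nilH t(2), of "k - i" j] ik(1) by simp
      then show "inv\<^bsub>H\<^esub> \<phi> h \<otimes>\<^bsub>H\<^esub> (inv\<^bsub>H\<^esub> \<phi> g \<otimes>\<^bsub>H\<^esub> \<phi> (g \<otimes>\<^bsub>G\<^esub> h)) \<in> upper_central_series H j"
        by (simp add: t_def \<psi>_def y(2)) (simp add: y_def)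
    qed
  qed
  from this[of c] have *: "inv\<^bsub>H\<^esub> \<phi> h \<otimes>\<^bsub>H\<^esub> (inv\<^bsub>H\<^esub> \<phi> g \<otimes>\<^bsub>H\<^esub> \<phi> (g \<otimes>\<^bsub>G\<^esub> h)) = \<one>\<^bsub>H\<^esub>"
    if "g \<in> carrier G" "h \<in> carrier G" for g h
    using that by simp
  show ?thesis
  proof (rule homI)
    fix g h assume gh: "g \<in> carrier G" "h \<in> carrier G"
    have "\<phi> g \<otimes>\<^bsub>H\<^esub> (\<phi> h \<otimes>\<^bsub>H\<^esub> (inv\<^bsub>H\<^esub> \<phi> h \<otimes>\<^bsub>H\<^esub> (inv\<^bsub>H\<^esub> \<phi> g \<otimes>\<^bsub>H\<^esub> \<phi> (g \<otimes>\<^bsub>G\<^esub> h)))) = \<phi> g \<otimes>\<^bsub>H\<^esub> \<phi> h"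
      using *[OF gh] gh by simp
    then show "\<phi> (g \<otimes>\<^bsub>G\<^esub> h) = \<phi> g \<otimes>\<^bsub>H\<^esub> \<phi> h"
      using gh by simp
  qed simp
qed

text \<open>\<open>real_kernel_coset\<close> with one point at the identity, applied to
  \<open>\<phi>\<close> and to its inverse, shows that \<open>\<phi>\<close> maps one real kernel
  onto the other.\<close>

lemma restrict_real_kernel:
  assumes nilG: "upper_central_series G c = carrier G" and nilH: "upper_central_series H c = carrier H"
    and one: "\<phi> \<one>\<^bsub>G\<^esub> = \<one>\<^bsub>H\<^esub>"
  shows "filtered_iso (G\<lparr>carrier := real_kernel G\<rparr>) (\<lambda>n. R n \<inter> real_kernel G)
    (H\<lparr>carrier := real_kernel H\<rparr>) (\<lambda>n. T n \<inter> real_kernel H) \<phi>"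
proof -
  let ?N = "real_kernel G" and ?M = "real_kernel H"
  interpret I: filtered_iso H T G R \<phi>'
    by (rule inverse_filtered_iso)
  have one': "\<phi>' \<one>\<^bsub>H\<^esub> = \<one>\<^bsub>G\<^esub>"
    using one by (metis A.one_closed inverse_simps(3))
  have N: "subgroup ?N G" and M: "subgroup ?M H"
    using A.real_kernel_normal B.real_kernel_normal normal_imp_subgroup by blast+
  have NG: "x \<in> carrier G" if "x \<in> ?N" for x
    using that subgroup.subset[OF N] by blast
  have MH: "x \<in> carrier H" if "x \<in> ?M" for x
    using that subgroup.subset[OF M] by blast
  have to: "\<phi> x \<in> ?M" if "x \<in> ?N" for x
    using real_kernel_coset[OF nilG one, of "\<one>\<^bsub>G\<^esub>" x] that NG one by simp
  have image_inverse: "\<phi>' x \<in> ?N" if "x \<in> ?M" for x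
    using I.real_kernel_coset[OF nilH one', of "\<one>\<^bsub>H\<^esub>" x] that MH one' by simp
  interpret NF: filtered_group "G\<lparr>carrier := ?N\<rparr>" "\<lambda>n. R n \<inter> ?N"
    by (rule A.subgroup_filtered[OF N])
  interpret MF: filtered_group "H\<lparr>carrier := ?M\<rparr>" "\<lambda>n. T n \<inter> ?M"
    by (rule B.subgroup_filtered[OF M])
  show ?thesis
  proof unfold_locales
    show "bij_betw \<phi> (carrier (G\<lparr>carrier := ?N\<rparr>)) (carrier (H\<lparr>carrier := ?M\<rparr>))"
      by (rule bij_betw_byWitness[where f' = "\<phi>'"]) (use to image_inverse NG MH in auto)
    fix u v n assume "u \<in> carrier (G\<lparr>carrier := ?N\<rparr>)" "v \<in> carrier (G\<lparr>carrier := ?N\<rparr>)"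
    then have uv: "u \<in> ?N" "v \<in> ?N" by auto
    then have "inv\<^bsub>G\<^esub> u \<otimes>\<^bsub>G\<^esub> v \<in> ?N" "inv\<^bsub>H\<^esub> \<phi> u \<otimes>\<^bsub>H\<^esub> \<phi> v \<in> ?M"
      using to N M by (simp_all add: subgroup.m_closed subgroup.m_inv_closed)
    then show "inv\<^bsub>G\<lparr>carrier := ?N\<rparr>\<^esub> u \<otimes>\<^bsub>G\<lparr>carrier := ?N\<rparr>\<^esub> v \<in> R n \<inter> ?N \<longleftrightarrow>
        inv\<^bsub>H\<lparr>carrier := ?M\<rparr>\<^esub> \<phi> u \<otimes>\<^bsub>H\<lparr>carrier := ?M\<rparr>\<^esub> \<phi> v \<in> T n \<inter> ?M"
      using uv to adj[OF NG[OF uv(1)] NG[OF uv(2)]] N M by simp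
  qed
qed

end

text \<open>Induction on a common bound \<open>c\<close> for the classes, with groups, families and
  map arbitrary: the induction hypothesis is applied to the real kernels, and there to every
  normalised isomorphism and not only to \<open>\<phi>\<close>.\<close>

theorem filtered_iso_hom:
  fixes G :: "('a, 'm) monoid_scheme" and H :: "('b, 'n) monoid_scheme"
  assumes "filtered_iso G R H T \<phi>" "torsion_free G" "torsion_free H"
    and "upper_central_series G c = carrier G" "upper_central_series H c = carrier H"
    and "\<phi> \<one>\<^bsub>G\<^esub> = \<one>\<^bsub>H\<^esub>"
  shows "\<phi> \<in> hom G H"
  using assms
proof (induction c arbitrary: G R H T \<phi>)
  case 0
  interpret filtered_iso G R H T \<phi>
    by (rule "0.prems")
  have "carrier H \<subseteq> upper_central_series H 1"
    by (rule B.upper_central_series_mono[of 0 1, unfolded "0.prems"(5)]) simp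
  then have "upper_central_series H 1 = carrier H"
    using B.upper_central_series_subset by blast
  then show ?case
    using hom_if_abelian "0.prems" by blast
next
  case (Suc c)
  interpret filtered_iso G R H T \<phi>
    by (rule Suc.prems)
  show ?case
  \<comment> \<open>\<open>upper_central_series_real_kernel\<close> lowers a class bound of at least
    2; the bound 1 is the abelian case.\<close>
  proof (cases c)
    case 0
    then show ?thesis
      using hom_if_abelian[OF Suc.prems(4,6,3)] Suc.prems(5) by simp
  next
    case (Suc c')
    let ?N = "real_kernel G" and ?M = "real_kernel H"
    have N: "subgroup ?N G" and M: "subgroup ?M H"
      using A.real_kernel_normal B.real_kernel_normal normal_imp_subgroup by blast+
    have hom: "\<psi> (m \<otimes>\<^bsub>G\<^esub> n) = \<psi> m \<otimes>\<^bsub>H\<^esub> \<psi> n"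
      if "filtered_iso G R H T \<psi>" "\<psi> \<one>\<^bsub>G\<^esub> = \<one>\<^bsub>H\<^esub>" "m \<in> ?N" "n \<in> ?N" for \<psi> m n
    proof -
      have "\<psi> \<in> hom (G\<lparr>carrier := ?N\<rparr>) (H\<lparr>carrier := ?M\<rparr>)"
      proof (rule Suc.IH)
        show "filtered_iso (G\<lparr>carrier := ?N\<rparr>) (\<lambda>n. R n \<inter> ?N) (H\<lparr>carrier := ?M\<rparr>) (\<lambda>n. T n \<inter> ?M) \<psi>"
          by (rule filtered_iso.restrict_real_kernel[OF that(1) Suc.prems(4,5) that(2)])
        show "torsion_free (G\<lparr>carrier := ?N\<rparr>)" "torsion_free (H\<lparr>carrier := ?M\<rparr>)"
          using A.torsion_free_subgroup B.torsion_free_subgroup N M Suc.prems by auto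
        show "upper_central_series (G\<lparr>carrier := ?N\<rparr>) c = carrier (G\<lparr>carrier := ?N\<rparr>)"
          using A.upper_central_series_real_kernel[OF Suc.prems(2)] Suc.prems(4) unfolding Suc by simp
        show "upper_central_series (H\<lparr>carrier := ?M\<rparr>) c = carrier (H\<lparr>carrier := ?M\<rparr>)"
          using B.upper_central_series_real_kernel[OF Suc.prems(3)] Suc.prems(5) unfolding Suc by simp
        show "\<psi> \<one>\<^bsub>G\<lparr>carrier := ?N\<rparr>\<^esub> = \<one>\<^bsub>H\<lparr>carrier := ?M\<rparr>\<^esub>"
          using that(2) by simp
      qed
      then show ?thesis
        using that(3,4) by (simp add: hom_def)
    qed
    show ?thesis
      by (rule hom_if_equivariant[OF Suc.prems(2,4,3,5,6)])
        (rule equivariant[OF Suc.prems(3,5,6) A.real_kernel_normal hom])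
  qed
qed

section \<open>From Cayley graphs to filtered groups\<close>

primrec doubling :: "('a, 'm) monoid_scheme \<Rightarrow> 'a set \<Rightarrow> nat \<Rightarrow> 'a set" where
  "doubling G S 0 = insert \<one>\<^bsub>G\<^esub> S"
| "doubling G S (Suc n) = {x \<otimes>\<^bsub>G\<^esub> y | x y. x \<in> doubling G S n \<and> y \<in> doubling G S n}"

text \<open>\<open>doubling G S n\<close> is the ball of radius \<open>2 ^ n\<close> about the
  identity. The identity put in at stage 0 makes the balls nested; two factors can thus be brought
  to a common stage, and the balls cover all that \<open>S\<close> generates.\<close>

lemma (in group) doubling_filtered_group:
  assumes "finite S" "symmetric_subset G S" "generating_set G S"
  shows "filtered_group G (doubling G S)"
proof -
  have S: "S \<subseteq> carrier G" and S_inv: "\<And>s. s \<in> S \<Longrightarrow> inv s \<in> S"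
    using assms(2) by (auto simp: symmetric_subset_def SET_INV_def)
  have sub: "doubling G S n \<subseteq> carrier G" for n
    using S by (induction n) auto
  have one: "\<one> \<in> doubling G S n" for n
  proof (induction n)
    case (Suc n)
    then show ?case
      by (force intro: exI[of _ \<one>])
  qed simp
  have Suc_mono: "doubling G S n \<subseteq> doubling G S (Suc n)" for n
  proof
    fix x assume x: "x \<in> doubling G S n"
    then have "x \<in> carrier G"
      using sub by blast
    then have "x = x \<otimes> \<one>"
      by simp
    then show "x \<in> doubling G S (Suc n)"
      using x one by auto
  qed
  have mono: "doubling G S m \<subseteq> doubling G S n" if "m \<le> n" for m n
    using lift_Suc_mono_le[of "doubling G S"] Suc_mono that by blast
  have "x \<in> generate G S \<Longrightarrow> \<exists>n. x \<in> doubling G S n" for x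
  proof (induction rule: generate.induct)
    case one
    then show ?case
      by (intro exI[of _ 0]) simp
  next
    case (incl h)
    then show ?case
      by (intro exI[of _ 0]) simp
  next
    case (inv h)
    then show ?case
      using S_inv by (intro exI[of _ 0]) simp
  next
    case (eng h1 h2)
    then obtain m n where "h1 \<in> doubling G S m" "h2 \<in> doubling G S n"
      by blast
    then have "h1 \<in> doubling G S (max m n)" "h2 \<in> doubling G S (max m n)"
      using mono[of m "max m n"] mono[of n "max m n"] by auto
    then have "h1 \<otimes> h2 \<in> doubling G S (Suc (max m n))"
      by auto
    then show ?case ..
  qed
  then have cover: "\<exists>n. x \<in> doubling G S n" if "x \<in> carrier G" for x
    using that assms(3) by (simp add: generating_set_def)
  have fin: "finite (doubling G S n)" for n
  proof (induction n)
    case (Suc n)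
    have "doubling G S (Suc n) = (\<lambda>(x, y). x \<otimes> y) ` (doubling G S n \<times> doubling G S n)"
      by auto
    then show ?case
      using Suc by simp
  qed (simp add: assms(1))
  have inv: "inv x \<in> doubling G S n" if "x \<in> doubling G S n" for x n
    using that
  proof (induction n arbitrary: x)
    case 0
    then show ?case
      using S_inv by auto
  next
    case (Suc n)
    then obtain a b where ab: "x = a \<otimes> b" "a \<in> doubling G S n" "b \<in> doubling G S n"
      by auto
    then have "inv x = inv b \<otimes> inv a"
      using sub by (simp add: inv_mult_group subset_iff)
    then show ?case
      using Suc.IH ab by auto
  qed
  show ?thesis
    by unfold_locales (use sub fin inv cover in auto)
qed

text \<open>\<open>w\<close> is the midpoint of a path from \<open>u\<close> to \<open>v\<close>.
  The right-hand side mentions only adjacency at stage \<open>n\<close>, which a graph isomorphism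
  can transport.\<close>

lemma (in group) doubling_Suc_iff:
  assumes A: "A \<subseteq> carrier G" and u: "u \<in> carrier G" and v: "v \<in> carrier G"
  shows "inv u \<otimes> v \<in> doubling G A (Suc n) \<longleftrightarrow>
    (\<exists>w \<in> carrier G. inv u \<otimes> w \<in> doubling G A n \<and> inv w \<otimes> v \<in> doubling G A n)"
proof
  have sub: "doubling G A n \<subseteq> carrier G" for n
    using A by (induction n) auto
  assume "inv u \<otimes> v \<in> doubling G A (Suc n)"
  then obtain x y where xy: "inv u \<otimes> v = x \<otimes> y" "x \<in> doubling G A n" "y \<in> doubling G A n"
    by auto
  then have c: "x \<in> carrier G" "y \<in> carrier G"
    using sub by blast+
  have "inv (u \<otimes> x) \<otimes> v = inv x \<otimes> (inv u \<otimes> v)"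
    using c u v by (simp add: inv_mult_group m_assoc)
  then have "inv (u \<otimes> x) \<otimes> v = y"
    unfolding xy(1) using c by simp
  then show "\<exists>w \<in> carrier G. inv u \<otimes> w \<in> doubling G A n \<and> inv w \<otimes> v \<in> doubling G A n"
    using xy c u by (intro bexI[of _ "u \<otimes> x"]) auto
next
  assume "\<exists>w \<in> carrier G. inv u \<otimes> w \<in> doubling G A n \<and> inv w \<otimes> v \<in> doubling G A n"
  then obtain w where w: "w \<in> carrier G" "inv u \<otimes> w \<in> doubling G A n" "inv w \<otimes> v \<in> doubling G A n"
    by blast
  have "inv u \<otimes> v = (inv u \<otimes> w) \<otimes> (inv w \<otimes> v)"
    using u v w(1) by (simp add: m_assoc)
  then show "inv u \<otimes> v \<in> doubling G A (Suc n)"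
    using w by auto
qed

text \<open>A bijection carries midpoints to midpoints, which gives the induction step. At stage 0
  the added identity stands for \<open>u = v\<close>, where injectivity enters.\<close>

lemma doubling_adjacent:
  assumes "group G" "group H" and bij: "bij_betw \<phi> (carrier G) (carrier H)"
    and S: "S \<subseteq> carrier G" and S': "S' \<subseteq> carrier H"
    and adj: "\<And>u v. u \<in> carrier G \<Longrightarrow> v \<in> carrier G \<Longrightarrow>
      inv\<^bsub>G\<^esub> u \<otimes>\<^bsub>G\<^esub> v \<in> S \<longleftrightarrow> inv\<^bsub>H\<^esub> \<phi> u \<otimes>\<^bsub>H\<^esub> \<phi> v \<in> S'"
    and "u \<in> carrier G" "v \<in> carrier G"
  shows "inv\<^bsub>G\<^esub> u \<otimes>\<^bsub>G\<^esub> v \<in> doubling G S n \<longleftrightarrow> inv\<^bsub>H\<^esub> \<phi> u \<otimes>\<^bsub>H\<^esub> \<phi> v \<in> doubling H S' n"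
proof -
  interpret G: group G by fact
  interpret H: group H by fact
  show ?thesis
    using assms(7,8)
  proof (induction n arbitrary: u v)
    case 0
    have cl: "\<phi> u \<in> carrier H" "\<phi> v \<in> carrier H"
      using bij 0 by (auto simp: bij_betw_def)
    have "inv\<^bsub>G\<^esub> u \<otimes>\<^bsub>G\<^esub> v = \<one>\<^bsub>G\<^esub> \<longleftrightarrow> u = v"
      using 0 by (metis G.inv_closed G.inv_cancel_left(2) G.l_inv G.r_one)
    moreover have "inv\<^bsub>H\<^esub> \<phi> u \<otimes>\<^bsub>H\<^esub> \<phi> v = \<one>\<^bsub>H\<^esub> \<longleftrightarrow> \<phi> u = \<phi> v"
      using cl by (metis H.inv_closed H.inv_cancel_left(2) H.l_inv H.r_one)
    moreover have "\<phi> u = \<phi> v \<longleftrightarrow> u = v"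
      using bij 0 by (auto simp: bij_betw_def inj_on_def)
    ultimately show ?case
      using adj 0 by simp
  next
    case (Suc n)
    have im: "\<phi> ` carrier G = carrier H"
      using bij by (simp add: bij_betw_def)
    have cl: "\<phi> x \<in> carrier H" if "x \<in> carrier G" for x
      using im that by blast
    show ?case
      unfolding G.doubling_Suc_iff[OF S Suc.prems] H.doubling_Suc_iff[OF S' cl[OF Suc.prems(1)] cl[OF Suc.prems(2)]]
        im[symmetric] bex_simps
      using Suc.IH Suc.prems by blast
  qed
qed

lemma (in group) cayley_graph_arc_iff:
  assumes "S \<subseteq> carrier G" "u \<in> carrier G" "v \<in> carrier G"
  shows "(u, v) \<in> parcs (cayley_graph G S) \<longleftrightarrow> inv u \<otimes> v \<in> S"
proof
  assume "(u, v) \<in> parcs (cayley_graph G S)"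
  then obtain s where "s \<in> S" "v = u \<otimes> s"
    by (auto simp: cayley_graph_def)
  then show "inv u \<otimes> v \<in> S"
    using assms by (auto simp: subset_iff)
next
  assume "inv u \<otimes> v \<in> S"
  moreover have "v = u \<otimes> (inv u \<otimes> v)"
    using assms by simp
  ultimately show "(u, v) \<in> parcs (cayley_graph G S)"
    using assms(2) by (auto simp: cayley_graph_def)
qed

theorem theorem1p3:
  fixes G1 :: "('a, 'm) monoid_scheme" and G2 :: "('b, 'n) monoid_scheme"
    and S1 :: "'a set" and S2 :: "'b set" and \<phi> :: "'a \<Rightarrow> 'b"
  assumes "group G1" and "torsion_free G1" and "nilpotent G1"
    and "group G2" and "torsion_free G2" and "nilpotent G2"
    and "finite S1" and "symmetric_subset G1 S1" and "generating_set G1 S1"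
    and "finite S2" and "symmetric_subset G2 S2" and "generating_set G2 S2"
    and "graph_isomorphism (cayley_graph G1 S1) (cayley_graph G2 S2) \<phi>"
  shows "affine_bijection G1 G2 \<phi>"
proof -
  interpret G1: group G1 by fact
  interpret G2: group G2 by fact
  have S: "S1 \<subseteq> carrier G1" "S2 \<subseteq> carrier G2"
    using assms(8,11) by (auto simp: symmetric_subset_def)
  have bij: "bij_betw \<phi> (carrier G1) (carrier G2)"
    using assms(13) by (simp add: graph_isomorphism_def cayley_graph_def)
  then have cl: "\<phi> x \<in> carrier G2" if "x \<in> carrier G1" for x
    using that by (auto simp: bij_betw_def)
  have adj: "inv\<^bsub>G1\<^esub> u \<otimes>\<^bsub>G1\<^esub> v \<in> S1 \<longleftrightarrow> inv\<^bsub>G2\<^esub> \<phi> u \<otimes>\<^bsub>G2\<^esub> \<phi> v \<in> S2"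
    if "u \<in> carrier G1" "v \<in> carrier G1" for u v
  proof -
    have "(u, v) \<in> parcs (cayley_graph G1 S1) \<longleftrightarrow> (\<phi> u, \<phi> v) \<in> parcs (cayley_graph G2 S2)"
      using assms(13) that by (simp add: graph_isomorphism_def) (simp add: cayley_graph_def)
    then show ?thesis
      using G1.cayley_graph_arc_iff[OF S(1) that] G2.cayley_graph_arc_iff[OF S(2) cl cl] that by blast
  qed
  interpret F1: filtered_group G1 "doubling G1 S1"
    by (rule G1.doubling_filtered_group) fact+
  interpret F2: filtered_group G2 "doubling G2 S2"
    by (rule G2.doubling_filtered_group) fact+
  interpret I: filtered_iso G1 "doubling G1 S1" G2 "doubling G2 S2" \<phi>
    using bij doubling_adjacent[OF \<open>group G1\<close> \<open>group G2\<close> bij S adj]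
    by unfold_locales auto
  let ?h = "\<phi> \<one>\<^bsub>G1\<^esub>"
  \<comment> \<open>The translate of \<open>\<phi>\<close> at the identity is normalised; the factor
    \<open>\<one>\<close> keeps it in the form of \<open>translate_filtered_iso\<close>.\<close>
  let ?\<alpha> = "\<lambda>x. inv\<^bsub>G2\<^esub> ?h \<otimes>\<^bsub>G2\<^esub> \<phi> (\<one>\<^bsub>G1\<^esub> \<otimes>\<^bsub>G1\<^esub> x)"
  have iso: "filtered_iso G1 (doubling G1 S1) G2 (doubling G2 S2) ?\<alpha>"
    by (rule I.translate_filtered_iso) simp
  obtain c1 where c1: "upper_central_series G1 c1 = carrier G1"
    using G1.upper_central_series_of_nilpotent assms(3) by blast
  obtain c2 where c2: "upper_central_series G2 c2 = carrier G2"
    using G2.upper_central_series_of_nilpotent assms(6) by blast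
  let ?c = "max c1 c2"
  have "upper_central_series G1 ?c = carrier G1"
    using G1.upper_central_series_mono[of c1 ?c] G1.upper_central_series_subset[of ?c] c1 by simp
  moreover have "upper_central_series G2 ?c = carrier G2"
    using G2.upper_central_series_mono[of c2 ?c] G2.upper_central_series_subset[of ?c] c2 by simp
  ultimately have "?\<alpha> \<in> hom G1 G2"
    using filtered_iso_hom[OF iso assms(2,5)] cl by simp
  then have "?\<alpha> \<in> iso G1 G2"
    using filtered_iso.bij[OF iso] by (simp add: iso_def)
  moreover have "\<phi> x = ?h \<otimes>\<^bsub>G2\<^esub> ?\<alpha> x" if "x \<in> carrier G1" for x
    using that cl by simp
  moreover have "?h \<in> carrier G2"
    using cl by simp
  ultimately show ?thesis
    unfolding affine_bijection_def by (intro bexI[of _ ?\<alpha>] bexI[of _ ?h] ballI)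
qed

end
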